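(* A finite TRS is polynomially terminating over $\mathbb{R}$ if and only if it is polynomially terminating over $\mathbb{R}_{\mathrm{alg}}$.
   Context: Let $\mathbb{R}_{\mathrm{alg}}$ denote the field of real algebraic numbers (real roots of nonzero univariate polynomials with rational coefficients). Let $\mathcal{R}$ be a finite TRS over a finite signature $\mathcal{F}$. For $D \in \{\mathbb{R}_{\mathrm{alg}},\mathbb{R}\}$ let $D_0 = \{x \in D : x \ge 0\}$. A polynomial interpretation over $D$ consists of a number $\delta \in D$ with $\delta > 0$ and, for every $n$-ary $f \in \mathcal{F}$, a polynomial $f_D \in D[x_1,\dots,x_n]$ with $f_D(x_1,\dots,x_n) \in D_0$ for all $x_1,\dots,x_n \in D_0$. Define $x >_{D_0,\delta} y$ iff $x - y \ge \delta$. Terms are evaluated under assignments $\alpha$ of variables into $D_0$ in the usual inductive way. The interpretation is strictly monotone if each $f_D$ is monotone in each argument with respect to $>_{D_0,\delta}$ on $D_0$, and compatible with $\mathcal{R}$ if $[\alpha](\ell) >_{D_0,\delta} [\alpha](r)$ for all rules $\ell\to r$ and all assignments $\alpha$ into $D_0$. $\mathcal{R}$ is polynomially terminating over $D$ if there exists a strictly monotone polynomial interpretation over $D$ compatible with $\mathcal{R}$. *)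

theory Defs
  imports
    Complex_Main
    "HOL-Library.Poly_Mapping"
    "HOL-Computational_Algebra.Polynomial"
begin

datatype (funs_trm: 'f, vars_trm: 'v) trm = Var 'v | Fun 'f "('f, 'v) trm list"

text \<open>A signature is a set \<open>F\<close> of function symbols together with an arity function \<open>ar\<close>,
  of which only the values on \<open>F\<close> matter.\<close>

fun wf_trm :: "'f set \<Rightarrow> ('f \<Rightarrow> nat) \<Rightarrow> ('f, 'v) trm \<Rightarrow> bool" where
  "wf_trm F ar (Var x) \<longleftrightarrow> True"
| "wf_trm F ar (Fun f ts) \<longleftrightarrow> f \<in> F \<and> length ts = ar f \<and> (\<forall>t\<in>set ts. wf_trm F ar t)"

definition is_rule :: "'f set \<Rightarrow> ('f \<Rightarrow> nat) \<Rightarrow> ('f, 'v) trm \<times> ('f, 'v) trm \<Rightarrow> bool" where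
  "is_rule F ar = (\<lambda>(l, r). wf_trm F ar l \<and> wf_trm F ar r \<and>
     (\<forall>x. l \<noteq> Var x) \<and> vars_trm r \<subseteq> vars_trm l)"

definition is_trs :: "'f set \<Rightarrow> ('f \<Rightarrow> nat) \<Rightarrow> (('f, 'v) trm \<times> ('f, 'v) trm) set \<Rightarrow> bool" where
  "is_trs F ar R \<longleftrightarrow> (\<forall>\<rho>\<in>R. is_rule F ar \<rho>)"

text \<open>A monomial is a finitely supported map from variable indices to exponents, a polynomial a
  finitely supported map from monomials to real coefficients. Indices start at \<open>0\<close>, so the
  indeterminates of an \<open>n\<close>-variate polynomial are those with index \<open>< n\<close>.\<close>

type_synonym real_mpoly = "(nat \<Rightarrow>\<^sub>0 nat) \<Rightarrow>\<^sub>0 real"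

definition mpolys :: "real set \<Rightarrow> nat \<Rightarrow> real_mpoly set" where
  "mpolys D n = {p. \<forall>m\<in>Poly_Mapping.keys p.
     Poly_Mapping.lookup p m \<in> D \<and> Poly_Mapping.keys m \<subseteq> {..<n}}"

text \<open>For \<open>p \<in> mpolys D n\<close> this is only meant to be applied to lists of length \<open>n\<close>.\<close>

definition eval_mpoly :: "real_mpoly \<Rightarrow> real list \<Rightarrow> real" where
  "eval_mpoly p xs = (\<Sum>m\<in>Poly_Mapping.keys p. Poly_Mapping.lookup p m *
     (\<Prod>i\<in>Poly_Mapping.keys m. (xs ! i) ^ Poly_Mapping.lookup m i))"

definition real_alg :: "real set" where
  "real_alg = {x. algebraic x}"

lemma real_alg_altdef:
  "real_alg = {x. \<exists>p. (\<forall>i. coeff p i \<in> \<rat>) \<and> p \<noteq> 0 \<and> poly p x = 0}"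
  by (simp add: real_alg_def algebraic_altdef)

definition nonneg :: "real set \<Rightarrow> real set" where
  "nonneg D = {x \<in> D. x \<ge> 0}"

definition gt_delta :: "real \<Rightarrow> real \<Rightarrow> real \<Rightarrow> bool" where
  "gt_delta \<delta> x y \<longleftrightarrow> x - y \<ge> \<delta>"

definition poly_interpretation ::
  "real set \<Rightarrow> 'f set \<Rightarrow> ('f \<Rightarrow> nat) \<Rightarrow> real \<Rightarrow> ('f \<Rightarrow> real_mpoly) \<Rightarrow> bool" where
  "poly_interpretation D F ar \<delta> I \<longleftrightarrow> \<delta> \<in> D \<and> \<delta> > 0 \<and>
     (\<forall>f\<in>F. I f \<in> mpolys D (ar f) \<and>
       (\<forall>xs. length xs = ar f \<and> set xs \<subseteq> nonneg D \<longrightarrow> eval_mpoly (I f) xs \<in> nonneg D))"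

fun eval_trm :: "('f \<Rightarrow> real_mpoly) \<Rightarrow> ('v \<Rightarrow> real) \<Rightarrow> ('f, 'v) trm \<Rightarrow> real" where
  "eval_trm I \<alpha> (Var x) = \<alpha> x"
| "eval_trm I \<alpha> (Fun f ts) = eval_mpoly (I f) (map (eval_trm I \<alpha>) ts)"

definition strictly_monotone ::
  "real set \<Rightarrow> 'f set \<Rightarrow> ('f \<Rightarrow> nat) \<Rightarrow> real \<Rightarrow> ('f \<Rightarrow> real_mpoly) \<Rightarrow> bool" where
  "strictly_monotone D F ar \<delta> I \<longleftrightarrow>
     (\<forall>f\<in>F. \<forall>xs. length xs = ar f \<and> set xs \<subseteq> nonneg D \<longrightarrow>
       (\<forall>i<ar f. \<forall>y\<in>nonneg D. gt_delta \<delta> (xs ! i) y \<longrightarrow>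
         gt_delta \<delta> (eval_mpoly (I f) xs) (eval_mpoly (I f) (xs[i := y]))))"

definition compatible ::
  "real set \<Rightarrow> real \<Rightarrow> ('f \<Rightarrow> real_mpoly) \<Rightarrow> (('f, 'v) trm \<times> ('f, 'v) trm) set \<Rightarrow> bool" where
  "compatible D \<delta> I R \<longleftrightarrow>
     (\<forall>(l, r)\<in>R. \<forall>\<alpha>. (\<forall>x. \<alpha> x \<in> nonneg D) \<longrightarrow>
       gt_delta \<delta> (eval_trm I \<alpha> l) (eval_trm I \<alpha> r))"

definition polynomially_terminating ::
  "real set \<Rightarrow> 'f set \<Rightarrow> ('f \<Rightarrow> nat) \<Rightarrow> (('f, 'v) trm \<times> ('f, 'v) trm) set \<Rightarrow> bool" where
  "polynomially_terminating D F ar R \<longleftrightarrow>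
     (\<exists>\<delta> I. poly_interpretation D F ar \<delta> I \<and> strictly_monotone D F ar \<delta> I \<and> compatible D \<delta> I R)"

end

theory Submission
  imports Defs
begin

text \<open>
  From algebraic to real numbers an interpretation can be kept, because all conditions are closed
  and the rationals are dense. Conversely, the coefficients of a real interpretation are a point of a
  set \<open>S\<close> defined by polynomial inequalities over \<open>\<rat>\<close> and universal quantifiers over
  reals. By Tarski--Seidenberg \<open>S\<close> is semialgebraic over \<open>\<rat>\<close>, and a nonempty semialgebraic set
  has an algebraic point: project \<open>S\<close> to one coordinate, choose an algebraic value there (a root,
  or a rational in an open interval), fix that coordinate, and go on with the next one.

  Tarski--Seidenberg is proved in the style of Cohen and Hoermander without any syntax of formulas. A set
  counts as semialgebraic if membership depends only on the signs of finitely many polynomials.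
  The key step shows that finitely many sign conditions on the parameters \<open>x\<close>, \<open>y\<close> give an order
  isomorphism \<open>\<phi>\<close> of the line such that each polynomial \<open>p x\<close> of a given finite family
  has at \<open>t\<close> the sign of \<open>p y\<close> at \<open>\<phi> t\<close>.
\<close>

section \<open>Matching the signs of real polynomials\<close>

definition order_iso :: "(real \<Rightarrow> real) \<Rightarrow> bool" where
  "order_iso \<phi> \<longleftrightarrow> strict_mono \<phi> \<and> surj \<phi>"

lemma order_iso_less [simp]: "order_iso \<phi> \<Longrightarrow> \<phi> s < \<phi> t \<longleftrightarrow> s < t"
  by (simp add: order_iso_def strict_mono_less)

lemma order_iso_le [simp]: "order_iso \<phi> \<Longrightarrow> \<phi> s \<le> \<phi> t \<longleftrightarrow> s \<le> t"
  by (simp add: order_iso_def strict_mono_less_eq)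

lemma order_iso_eq [simp]: "order_iso \<phi> \<Longrightarrow> \<phi> s = \<phi> t \<longleftrightarrow> s = t"
  by (simp add: order_iso_def strict_mono_eq)

lemma order_iso_surj: "order_iso \<phi> \<Longrightarrow> \<exists>s. t = \<phi> s"
  by (simp add: order_iso_def surj_def)

lemma order_iso_id: "order_iso (\<lambda>t. t)"
  by (simp add: order_iso_def strict_mono_def surj_def)

lemma order_iso_reflect:
  assumes "order_iso \<phi>"
  shows "order_iso (\<lambda>t. - \<phi> (- t))"
proof -
  have "\<exists>s. t = - \<phi> (- s)" for t
    using order_iso_surj[OF assms, of "- t"] by (metis minus_minus)
  then show ?thesis
    using assms unfolding order_iso_def by (auto simp: strict_mono_def surj_def)
qed

text \<open>Points are added from left to right: a single point is met by a translation, and beyond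
  the largest old point \<open>m\<close> the map is replaced by the ray from \<open>(m, f m)\<close>
  through \<open>(b, f b)\<close>.\<close>

lemma order_iso_extending:
  fixes f :: "real \<Rightarrow> real"
  assumes "finite A" "\<And>s t. s \<in> A \<Longrightarrow> t \<in> A \<Longrightarrow> s < t \<Longrightarrow> f s < f t"
  shows "\<exists>\<psi>. order_iso \<psi> \<and> (\<forall>a\<in>A. \<psi> a = f a)"
  using assms
proof (induction A rule: finite_linorder_max_induct)
  case empty
  then show ?case using order_iso_id by blast
next
  case (insert b A)
  then obtain \<psi> where \<psi>: "order_iso \<psi>" "\<forall>a\<in>A. \<psi> a = f a" by blast
  show ?case
  proof (cases "A = {}")
    case True
    have "order_iso (\<lambda>t. t + (f b - b))"
      unfolding order_iso_def strict_mono_def surj_def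
      by (auto intro: exI[of _ "x - (f b - b)" for x])
    then show ?thesis using True by (intro exI[of _ "\<lambda>t. t + (f b - b)"]) auto
  next
    case False
    define m where "m = Max A"
    have m: "m \<in> A" "\<forall>a\<in>A. a \<le> m" using insert False by (auto simp: m_def)
    then have mb: "m < b" "f m < f b" using insert by auto
    define k where "k = (f b - f m) / (b - m)"
    have k: "k > 0" using mb by (simp add: k_def)
    define \<chi> where "\<chi> = (\<lambda>t. if t \<le> m then \<psi> t else f m + (t - m) * k)"
    have fm: "\<psi> m = f m" using \<psi> m by auto
    have "\<chi> s < \<chi> t" if "s < t" for s t
    proof -
      have "\<psi> s \<le> f m" if "s \<le> m" using that \<psi> fm by (metis order_iso_le)
      moreover have "0 < (t - m) * k" if "m < t" using that k by simp
      moreover have "(s - m) * k < (t - m) * k" using \<open>s < t\<close> k by simp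
      ultimately show ?thesis using that \<psi>(1) by (auto simp: \<chi>_def)
    qed
    moreover have "\<exists>t. u = \<chi> t" for u
    proof (cases "u \<le> f m")
      case True
      obtain t where "u = \<psi> t" using order_iso_surj \<psi> by blast
      then show ?thesis using True fm \<psi>(1) by (metis \<chi>_def order_iso_le)
    next
      case False
      then have "u = \<chi> (m + (u - f m) / k)" using k by (auto simp: \<chi>_def field_simps)
      then show ?thesis by blast
    qed
    ultimately have "order_iso \<chi>" by (auto simp: order_iso_def strict_mono_def surj_def)
    moreover have "\<chi> b = f b" using mb by (simp add: \<chi>_def k_def)
    moreover have "\<chi> a = f a" if "a \<in> A" for a using that m \<psi> by (simp add: \<chi>_def)
    ultimately show ?thesis by blast
  qed
qed

text \<open>Connectedness in the complement of \<open>Z\<close>, put in terms of order so that only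
  comparisons with points of \<open>Z\<close> occur. The relation is not reflexive on
  \<open>Z\<close>: it includes that both points avoid \<open>Z\<close>.\<close>

definition same_comp :: "real set \<Rightarrow> real \<Rightarrow> real \<Rightarrow> bool" where
  "same_comp Z s t \<longleftrightarrow> Z \<inter> {min s t..max s t} = {}"

lemma same_comp_refl: "t \<notin> Z \<Longrightarrow> same_comp Z t t"
  by (simp add: same_comp_def)

lemma same_comp_sym: "same_comp Z s t \<Longrightarrow> same_comp Z t s"
  by (simp add: same_comp_def min.commute max.commute)

lemma same_comp_trans: "same_comp Z s t \<Longrightarrow> same_comp Z t u \<Longrightarrow> same_comp Z s u"
  unfolding same_comp_def by (fastforce simp: min_def max_def split: if_splits)

lemma same_comp_between: "same_comp Z s t \<Longrightarrow> s \<le> u \<Longrightarrow> u \<le> t \<Longrightarrow> same_comp Z s u"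
  unfolding same_comp_def by (fastforce simp: min_def max_def split: if_splits)

lemma same_comp_notin: "same_comp Z s t \<Longrightarrow> s \<notin> Z \<and> t \<notin> Z"
  unfolding same_comp_def by auto

lemma same_comp_less: "same_comp Z s t \<Longrightarrow> z \<in> Z \<Longrightarrow> z < s \<longleftrightarrow> z < t"
  unfolding same_comp_def by (fastforce simp: min_def max_def split: if_splits)

lemma same_comp_uminus: "same_comp (uminus ` Z) (- s) (- t) \<longleftrightarrow> same_comp Z s t"
  unfolding same_comp_def by (force simp: min_def max_def split: if_splits)

section \<open>Signs of a single real polynomial\<close>

lemma poly_sgn_change:
  fixes p :: "real poly"
  assumes "sgn (poly p s) \<noteq> sgn (poly p t)"
  shows "\<exists>z. min s t \<le> z \<and> z \<le> max s t \<and> poly p z = 0"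
proof (cases "poly p s = 0 \<or> poly p t = 0")
  case True
  then show ?thesis by (metis max.cobounded1 max.cobounded2 min.cobounded1 min.cobounded2)
next
  case False
  then have "s \<noteq> t" "poly p s * poly p t < 0"
    using assms by (auto simp: sgn_if mult_less_0_iff split: if_splits)
  then show ?thesis
    using poly_IVT[of s t p] poly_IVT[of t s p]
    by (cases "s < t") (auto simp: mult.commute min_def max_def intro: less_imp_le)
qed

text \<open>Serves the component to the right of all of \<open>Z\<close>, where no further point of
  \<open>Z\<close> provides a sign. A derivative that stays positive has a positive leading
  coefficient, and then so has \<open>q\<close>.\<close>

lemma poly_pinfty_pos:
  fixes q :: "real poly"
  assumes "\<And>u. u \<ge> t \<Longrightarrow> poly (pderiv q) u > 0"
  shows "\<exists>u>t. poly q u > 0"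
proof -
  have lim: "\<exists>u. \<forall>v\<ge>u. lead_coeff r \<le> poly r v" if "lead_coeff r > 0" for r :: "real poly"
    using poly_pinfty_gt_lc[OF that] by blast
  have "lead_coeff (pderiv q) > 0"
  proof (rule ccontr)
    assume "\<not> ?thesis"
    moreover have "pderiv q \<noteq> 0" using assms[of t] by auto
    ultimately have "lead_coeff (- pderiv q) > 0" by (simp add: order_less_le)
    then obtain u where "\<forall>v\<ge>u. lead_coeff (- pderiv q) \<le> poly (- pderiv q) v" using lim by blast
    then have "poly (- pderiv q) (max u t) > 0"
      using \<open>lead_coeff (- pderiv q) > 0\<close> by (meson max.cobounded1 order_less_le_trans)
    then show False using assms[of "max u t"] by simp
  qed
  moreover have "degree q \<noteq> 0" using assms[of t] by (auto simp: pderiv_eq_0_iff[symmetric])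
  ultimately have "lead_coeff q > 0"
    by (simp add: degree_pderiv coeff_pderiv zero_less_mult_iff)
  then obtain u where "\<forall>v\<ge>u. lead_coeff q \<le> poly q v" using lim by blast
  then have "poly q (max u (t + 1)) > 0"
    using \<open>lead_coeff q > 0\<close> by (meson max.cobounded1 order_less_le_trans)
  then show ?thesis by (intro exI[of _ "max u (t + 1)"]) auto
qed

text \<open>The two order isomorphisms \<open>\<alpha>\<close> and \<open>\<beta>\<close> make the situation symmetric in \<open>p\<close> and \<open>q\<close>; one of them is
  always the identity in applications.\<close>

locale sgn_matched =
  fixes \<alpha> \<beta> :: "real \<Rightarrow> real" and Z :: "real set" and p q :: "real poly"
  assumes iso: "order_iso \<alpha>" "order_iso \<beta>"
    and finite: "finite Z"
    and sgn_Z: "z \<in> Z \<Longrightarrow> sgn (poly p (\<alpha> z)) = sgn (poly q (\<beta> z))"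
    and sgn_pderiv: "sgn (poly (pderiv p) (\<alpha> t)) = sgn (poly (pderiv q) (\<beta> t))"
    and critical: "poly (pderiv p) (\<alpha> t) = 0 \<Longrightarrow> t \<in> Z"
begin

lemma swap: "sgn_matched \<beta> \<alpha> Z q p"
  using iso finite sgn_Z sgn_pderiv critical
  by unfold_locales (simp_all, metis sgn_0_0)

lemma neg: "sgn_matched \<alpha> \<beta> Z (- p) (- q)"
  using iso finite sgn_Z sgn_pderiv critical
  by unfold_locales (simp_all add: pderiv_minus sgn_minus)

text \<open>The derivative of -p(-t) is p'(-t): an increasing polynomial stays increasing, while
  left and right as well as the sign are exchanged. Searching a root to the left thus reduces to
  searching to the right.\<close>

lemma reflect:
  "sgn_matched (\<lambda>t. - \<alpha> (- t)) (\<lambda>t. - \<beta> (- t)) (uminus ` Z)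
     (- pcompose p [:0, -1:]) (- pcompose q [:0, -1:])"
proof
  fix t assume "poly (pderiv (- pcompose p [:0, -1:])) (- \<alpha> (- t)) = 0"
  then have "- t \<in> Z" using critical by (simp add: pderiv_minus pderiv_pcompose poly_pcompose pderiv_pCons)
  then show "t \<in> uminus ` Z" by (metis image_eqI minus_minus)
qed (use iso finite sgn_Z sgn_pderiv in
  \<open>auto simp: order_iso_reflect pderiv_minus pderiv_pcompose poly_pcompose pderiv_pCons sgn_minus\<close>)

text \<open>By the intermediate value theorem a sign change needs a zero of the derivative in
  between, and \<open>critical\<close> puts all of these into \<open>Z\<close>.\<close>

lemma sgn_pderiv_const:
  assumes "same_comp Z s t"
  shows "sgn (poly (pderiv p) (\<alpha> s)) = sgn (poly (pderiv p) (\<alpha> t))"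
proof (rule ccontr)
  assume "\<not> ?thesis"
  then obtain u where u: "min (\<alpha> s) (\<alpha> t) \<le> u" "u \<le> max (\<alpha> s) (\<alpha> t)" "poly (pderiv p) u = 0"
    using poly_sgn_change by blast
  obtain v where v: "u = \<alpha> v" using order_iso_surj iso by blast
  have "v \<in> Z" using u v critical by blast
  moreover have "v \<in> {min s t..max s t}" using u iso by (auto simp: v min_le_iff_disj le_max_iff_disj)
  ultimately show False using assms by (auto simp: same_comp_def)
qed

text \<open>Mean value theorem. The end \<open>t\<close> may itself lie in \<open>Z\<close>;
  \<open>root_right\<close> applies this to the next point of \<open>Z\<close>.\<close>

lemma increasing:
  assumes "poly (pderiv p) (\<alpha> s) > 0" "s < t" "\<And>u. s < u \<Longrightarrow> u < t \<Longrightarrow> same_comp Z s u"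
  shows "poly p (\<alpha> s) < poly p (\<alpha> t)"
proof -
  have "\<alpha> s < \<alpha> t" using assms iso by simp
  then obtain u where u: "\<alpha> s < u" "u < \<alpha> t"
      "poly p (\<alpha> t) - poly p (\<alpha> s) = (\<alpha> t - \<alpha> s) * poly (pderiv p) u"
    using poly_MVT by blast
  obtain v where v: "u = \<alpha> v" using order_iso_surj iso by blast
  have "same_comp Z s v" using u v iso assms(3) by simp
  then have "poly (pderiv p) u > 0" using sgn_pderiv_const assms(1) v by (metis sgn_greater)
  then show ?thesis using u \<open>\<alpha> s < \<alpha> t\<close> by (metis diff_gt_0_iff_gt zero_less_mult_iff)
qed

text \<open>At the next point \<open>z\<close> of \<open>Z\<close> the increasing \<open>p\<close>
  is positive, hence so is \<open>q\<close> by \<open>sgn_Z\<close>, and \<open>q\<close> must cross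
  zero before \<open>z\<close>. Without such a point \<open>q\<close> has positive derivative all
  the way to infinity.\<close>

lemma root_right:
  assumes t: "t \<notin> Z" and inc: "poly (pderiv p) (\<alpha> t) > 0"
    and sg: "poly p (\<alpha> t) \<ge> 0" "poly q (\<beta> t) < 0"
  shows "\<exists>s>t. same_comp Z t s \<and> poly q (\<beta> s) = 0"
proof (cases "\<exists>z\<in>Z. z > t")
  case True
  define z where "z = Min {z\<in>Z. z > t}"
  have "z \<in> {z\<in>Z. z > t}" unfolding z_def using True finite by (intro Min_in) auto
  then have z: "z \<in> Z" "z > t" by auto
  have least: "z \<le> z'" if "z' \<in> Z" "t < z'" for z'
    unfolding z_def using that finite by (intro Min_le) auto
  have comp: "same_comp Z t s" if "t < s" "s < z" for s
    using that least t unfolding same_comp_def by (force simp: order_le_less)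
  have "poly p (\<alpha> z) > 0" using increasing[OF inc z(2) comp] sg by linarith
  then have "poly q (\<beta> z) > 0" using sgn_Z[OF z(1)] by (metis sgn_greater)
  moreover have "\<beta> t < \<beta> z" using iso z by simp
  ultimately obtain u where u: "\<beta> t < u" "u < \<beta> z" "poly q u = 0"
    using poly_IVT_pos sg by blast
  obtain s where "u = \<beta> s" using order_iso_surj iso by blast
  then show ?thesis using u iso comp by auto
next
  case False
  have comp: "same_comp Z t s" if "t \<le> s" for s
    using that False t unfolding same_comp_def
    by (auto simp: min_def max_def not_less order_le_less)
  have "poly (pderiv q) u > 0" if u: "u \<ge> \<beta> t" for u
  proof -
    obtain s where s: "u = \<beta> s" using order_iso_surj iso by blast
    have "same_comp Z t s" using u s iso comp by simp
    then show ?thesis using sgn_pderiv_const sgn_pderiv inc s by (metis sgn_greater)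
  qed
  then obtain u where "u > \<beta> t" "poly q u > 0" using poly_pinfty_pos by blast
  then obtain v where v: "\<beta> t < v" "poly q v = 0" using poly_IVT_pos sg by blast
  obtain s where "v = \<beta> s" using order_iso_surj iso by blast
  then show ?thesis using v iso comp by auto
qed

lemma root_exists_increasing:
  assumes "t \<notin> Z" "poly (pderiv p) (\<alpha> t) > 0" "poly p (\<alpha> t) = 0"
  shows "\<exists>s. same_comp Z t s \<and> poly q (\<beta> s) = 0"
proof (cases "poly q (\<beta> t)" "0 :: real" rule: linorder_cases)
  case less
  then show ?thesis using root_right assms by (metis order_refl)
next
  case equal
  then show ?thesis using same_comp_refl assms by blast
next
  case greater
  \<comment> \<open>Here \<open>q\<close> is positive at \<open>\<beta> t\<close> and increasing, so
    its root is to be found on the left; the reflection turns this into the situation of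
    \<open>root_right\<close>.\<close>
  interpret r: sgn_matched "\<lambda>t. - \<alpha> (- t)" "\<lambda>t. - \<beta> (- t)" "uminus ` Z"
     "- pcompose p [:0, -1:]" "- pcompose q [:0, -1:]"
    by (rule reflect)
  obtain s where "same_comp (uminus ` Z) (- t) s" "poly q (\<beta> (- s)) = 0"
    using r.root_right[of "- t"] assms greater
    by (auto simp: pderiv_minus pderiv_pcompose poly_pcompose pderiv_pCons inj_image_mem_iff)
  then show ?thesis using same_comp_uminus[of Z t "- s"] by auto
qed

lemma root_exists:
  assumes "t \<notin> Z" "poly p (\<alpha> t) = 0"
  shows "\<exists>s. same_comp Z t s \<and> poly q (\<beta> s) = 0"
proof (cases "poly (pderiv p) (\<alpha> t) > 0")
  case True
  then show ?thesis using root_exists_increasing assms by blast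
next
  case False
  interpret n: sgn_matched \<alpha> \<beta> Z "- p" "- q" by (rule neg)
  have "poly (pderiv p) (\<alpha> t) < 0" using False critical assms(1) by (meson linorder_cases)
  then show ?thesis using n.root_exists_increasing assms by (simp add: pderiv_minus)
qed

text \<open>Rolle's theorem: between two roots the derivative vanishes, which gives a point of
  \<open>Z\<close> between \<open>s\<close> and \<open>t\<close>.\<close>

lemma root_unique:
  assumes "same_comp Z s t" "poly p (\<alpha> s) = 0" "poly p (\<alpha> t) = 0"
  shows "s = t"
proof -
  have False if "s < t" "same_comp Z s t" "poly p (\<alpha> s) = 0" "poly p (\<alpha> t) = 0" for s t
  proof -
    have "\<alpha> s < \<alpha> t" using that iso by simp
    then obtain u where u: "\<alpha> s < u" "u < \<alpha> t"
        "poly p (\<alpha> t) - poly p (\<alpha> s) = (\<alpha> t - \<alpha> s) * poly (pderiv p) u"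
      using poly_MVT by blast
    obtain v where v: "u = \<alpha> v" using order_iso_surj iso by blast
    have "v \<in> Z" using u v that \<open>\<alpha> s < \<alpha> t\<close> critical by auto
    then show False using same_comp_between[OF that(2)] u v iso same_comp_notin by (metis less_imp_le order_iso_less)
  qed
  then show ?thesis using assms same_comp_sym by (metis linorder_cases)
qed

text \<open>Otherwise \<open>root_right\<close> gives a root of \<open>q\<close> further right in
  the same component, but there \<open>p\<close> has grown and is positive, against the common
  roots.\<close>

lemma not_opposite_increasing:
  assumes roots: "\<And>s. poly p (\<alpha> s) = 0 \<longleftrightarrow> poly q (\<beta> s) = 0"
    and "t \<notin> Z" "poly (pderiv p) (\<alpha> t) > 0" "poly p (\<alpha> t) > 0"
  shows "\<not> poly q (\<beta> t) < 0"
proof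
  assume "poly q (\<beta> t) < 0"
  then obtain s where s: "s > t" "same_comp Z t s" "poly q (\<beta> s) = 0"
    using root_right assms by (metis less_imp_le)
  then have "poly p (\<alpha> t) < poly p (\<alpha> s)"
    using increasing assms same_comp_between by (metis less_imp_le)
  then show False using roots[of s] s(3) assms(4) by simp
qed

end

lemma (in sgn_matched) sgn_eq_increasing:
  assumes roots: "\<And>s. poly p (\<alpha> s) = 0 \<longleftrightarrow> poly q (\<beta> s) = 0"
    and "t \<notin> Z" "poly (pderiv p) (\<alpha> t) > 0"
  shows "sgn (poly p (\<alpha> t)) = sgn (poly q (\<beta> t))"
proof -
  interpret s: sgn_matched \<beta> \<alpha> Z q p by (rule swap)
  have "poly (pderiv q) (\<beta> t) > 0" using sgn_pderiv assms(3) by (metis sgn_greater)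
  then have "poly p (\<alpha> t) > 0 \<Longrightarrow> \<not> poly q (\<beta> t) < 0" "poly q (\<beta> t) > 0 \<Longrightarrow> \<not> poly p (\<alpha> t) < 0"
    using not_opposite_increasing[OF assms] s.not_opposite_increasing[OF roots[symmetric] assms(2)]
    by blast+
  then show ?thesis
    using roots[of t]
    by (cases "poly p (\<alpha> t)" "0 :: real" rule: linorder_cases;
        cases "poly q (\<beta> t)" "0 :: real" rule: linorder_cases) auto
qed

text \<open>Off \<open>Z\<close> the derivatives are nonzero with equal sign, so up to negation both
  polynomials are increasing there; common roots and the exclusion of opposite signs leave only
  equal signs.\<close>

lemma (in sgn_matched) sgn_eq:
  assumes roots: "\<And>s. poly p (\<alpha> s) = 0 \<longleftrightarrow> poly q (\<beta> s) = 0"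
  shows "sgn (poly p (\<alpha> t)) = sgn (poly q (\<beta> t))"
proof (cases "t \<in> Z")
  case False
  interpret n: sgn_matched \<alpha> \<beta> Z "- p" "- q" by (rule neg)
  show ?thesis
  proof (cases "poly (pderiv p) (\<alpha> t) > 0")
    case True
    then show ?thesis using sgn_eq_increasing assms False by blast
  next
    case not_inc: False
    then have "poly (pderiv p) (\<alpha> t) < 0" using critical False by (meson linorder_cases)
    then show ?thesis using n.sgn_eq_increasing[of t] roots False
      by (auto simp: pderiv_minus sgn_minus)
  qed
qed (use sgn_Z in blast)

section \<open>Matching the signs of whole families of polynomials\<close>

definition sgn_match :: "(real \<Rightarrow> real) \<Rightarrow> (real poly \<times> real poly) set \<Rightarrow> bool" where
  "sgn_match \<phi> M \<longleftrightarrow> (\<forall>(p, q)\<in>M. \<forall>t. sgn (poly p t) = sgn (poly q (\<phi> t)))"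

text \<open>The zero polynomial is left out because it vanishes everywhere and would make the set
  infinite.\<close>

definition zeros :: "(real poly \<times> real poly) set \<Rightarrow> real set" where
  "zeros M = {t. \<exists>(p, q)\<in>M. p \<noteq> 0 \<and> poly p t = 0}"

lemma finite_zeros: "finite M \<Longrightarrow> finite (zeros M)"
proof -
  assume "finite M"
  moreover have "zeros M = (\<Union>m\<in>{m \<in> M. fst m \<noteq> 0}. {t. poly (fst m) t = 0})"
    by (fastforce simp: zeros_def)
  ultimately show ?thesis using poly_roots_finite by auto
qed

text \<open>A sign change of \<open>q\<close> between \<open>\<phi> t\<close> and
  \<open>\<psi> t\<close> produces a root \<open>\<phi> z = \<psi> z\<close> in between;
  monotonicity of both maps squeezes \<open>z\<close> to \<open>t\<close>, so that the two values
  coincide.\<close>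

lemma sgn_match_cong_zeros:
  assumes iso: "order_iso \<phi>" "order_iso \<psi>" and M: "sgn_match \<phi> M"
    and eq: "\<forall>z\<in>zeros M. \<psi> z = \<phi> z"
  shows "sgn_match \<psi> M"
proof -
  have "sgn (poly p t) = sgn (poly q (\<psi> t))" if pq: "(p, q) \<in> M" for p q t
  proof (rule ccontr)
    assume neq: "\<not> ?thesis"
    have m: "sgn (poly p t) = sgn (poly q (\<phi> t))" for t
      using M pq by (auto simp: sgn_match_def)
    then have "sgn (poly q (\<phi> t)) \<noteq> sgn (poly q (\<psi> t))" using neq by simp
    then obtain u where u: "min (\<phi> t) (\<psi> t) \<le> u" "u \<le> max (\<phi> t) (\<psi> t)" "poly q u = 0"
      using poly_sgn_change by blast
    obtain z where z: "u = \<phi> z" using order_iso_surj iso by blast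
    have pz: "poly p z = 0" using m u z by (metis sgn_0_0)
    \<comment> \<open>\<open>zeros M\<close> sees only nonzero \<open>p\<close>. If
      \<open>p = 0\<close>, then \<open>q\<close> vanishes identically because \<open>\<phi>\<close>
      is onto, and the signs cannot differ.\<close>
    have "p \<noteq> 0"
    proof
      assume "p = 0"
      then have "poly q s = 0" for s
        using m order_iso_surj[OF iso(1), of s] by (metis poly_0 sgn_0_0)
      then show False using neq \<open>p = 0\<close> by simp
    qed
    then have "z \<in> zeros M" using pq pz by (auto simp: zeros_def)
    then have eqz: "\<psi> z = \<phi> z" using eq by blast
    have "z = t"
    proof (cases "\<phi> t \<le> \<psi> t")
      case True
      then show ?thesis using u z eqz iso by (metis max.absorb2 min.absorb1 order_antisym order_iso_le)
    next
      case False
      then show ?thesis using u z eqz iso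
        by (metis linear max.absorb1 min.absorb2 order_antisym order_iso_le)
    qed
    then show False using neq m eqz by metis
  qed
  then show ?thesis by (auto simp: sgn_match_def)
qed

text \<open>Between consecutive zeros of \<open>M\<close> both \<open>p\<close> and \<open>q\<close> are strictly monotone, so whether they have a root there
  is decided by their signs at the zeros; \<open>\<psi>\<close> is \<open>\<phi>\<close> corrected to send roots of \<open>p\<close> to roots of \<open>q\<close>.\<close>

lemma sgn_match_extend:
  assumes iso: "order_iso \<phi>" and fin: "finite M" and M: "sgn_match \<phi> M"
    and deriv: "(pderiv p, pderiv q) \<in> M" "pderiv p \<noteq> 0"
    and Z: "\<forall>z\<in>zeros M. sgn (poly p z) = sgn (poly q (\<phi> z))"
  shows "\<exists>\<psi>. order_iso \<psi> \<and> sgn_match \<psi> (insert (p, q) M) \<and> (\<forall>z\<in>zeros M. \<psi> z = \<phi> z)"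
proof -
  define Z where "Z = zeros M"
  \<comment> \<open>Stated for all \<open>\<chi>\<close>: it is used for \<open>\<phi>\<close> to
    construct \<open>\<psi>\<close>, and then for \<open>\<psi>\<close> itself.\<close>
  have matched: "sgn_matched (\<lambda>t. t) \<chi> Z p q"
    if "order_iso \<chi>" "sgn_match \<chi> M" "\<forall>z\<in>Z. \<chi> z = \<phi> z" for \<chi>
  proof
    show "sgn (poly (pderiv p) t) = sgn (poly (pderiv q) (\<chi> t))" for t
      using deriv(1) that by (auto simp: sgn_match_def)
    show "t \<in> Z" if "poly (pderiv p) t = 0" for t
      using that deriv by (auto simp: Z_def zeros_def)
  qed (use that fin Z in \<open>auto simp: Z_def finite_zeros order_iso_id\<close>)
  interpret a: sgn_matched "\<lambda>t. t" \<phi> Z p q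
    by (rule matched[OF iso M]) simp
  interpret b: sgn_matched \<phi> "\<lambda>t. t" Z q p
    by (rule a.swap)
  have p0: "p \<noteq> 0" using deriv by auto
  define A where "A = Z \<union> {t. poly p t = 0}"
  have finA: "finite A" using a.finite p0 poly_roots_finite by (auto simp: A_def)
  \<comment> \<open>\<open>\<phi> (g t)\<close> is the value intended for \<open>\<psi> t\<close>.
    On \<open>Z\<close> nothing changes; for another root \<open>t\<close> of \<open>p\<close> it is
    a root of \<open>q\<close>, with \<open>g t\<close> in the component of
    \<open>t\<close>.\<close>
  define g where "g = (\<lambda>t. if t \<in> Z then t else SOME s. same_comp Z t s \<and> poly q (\<phi> s) = 0)"
  have g: "same_comp Z t (g t)" "poly q (\<phi> (g t)) = 0" if "t \<in> A" "t \<notin> Z" for t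
  proof -
    have "\<exists>s. same_comp Z t s \<and> poly q (\<phi> s) = 0" using a.root_exists that by (auto simp: A_def)
    from someI_ex[OF this] show "same_comp Z t (g t)" "poly q (\<phi> (g t)) = 0"
      using that by (auto simp: g_def)
  qed
  have gZ: "g t = t" if "t \<in> Z" for t using that by (simp add: g_def)
  have g_less: "z < g t \<longleftrightarrow> z < t" if "z \<in> Z" "t \<in> A" for z t
    using that same_comp_less[OF g(1)] gZ by (cases "t \<in> Z") auto
  have g_greater: "g t < z \<longleftrightarrow> t < z" if "z \<in> Z" "t \<in> A" for z t
  proof (cases "t \<in> Z")
    case False
    then have "g t \<noteq> z" "t \<noteq> z" using that same_comp_notin[OF g(1)] by auto
    then show ?thesis using g_less[OF that] by linarith
  qed (simp add: gZ)
  have mono: "\<phi> (g s) < \<phi> (g t)" if st: "s \<in> A" "t \<in> A" "s < t" for s t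
  proof -
    have "g s < g t"
    proof (cases "s \<in> Z \<or> t \<in> Z")
      case True
      then show ?thesis using st g_less[of s t] g_greater[of t s] gZ[of s] gZ[of t] by auto
    next
      case False
      \<comment> \<open>Two roots of \<open>p\<close> off \<open>Z\<close> are separated by a point
        of \<open>Z\<close>, and \<open>g\<close> keeps the position relative to
        \<open>Z\<close>.\<close>
      then have "poly p s = 0" "poly p t = 0" using st by (auto simp: A_def)
      then have "\<not> same_comp Z s t" using a.root_unique st by blast
      then obtain z where z: "z \<in> Z" "s \<le> z" "z \<le> t"
        using st by (auto simp: same_comp_def)
      then have "s < z" "z < t" using False by (auto simp: order_less_le)
      then show ?thesis using z st g_less g_greater by (meson order.strict_trans)
    qed
    then show ?thesis using iso by simp
  qed
  have "\<exists>\<psi>. order_iso \<psi> \<and> (\<forall>a\<in>A. \<psi> a = \<phi> (g a))"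
    by (rule order_iso_extending[OF finA]) (rule mono)
  then obtain \<psi> where \<psi>: "order_iso \<psi>" "\<forall>a\<in>A. \<psi> a = \<phi> (g a)"
    by blast
  have \<psi>Z: "\<forall>z\<in>Z. \<psi> z = \<phi> z"
  proof
    fix z assume "z \<in> Z"
    then show "\<psi> z = \<phi> z" using bspec[OF \<psi>(2), of z] gZ[of z] by (simp add: A_def)
  qed
  have \<psi>M: "sgn_match \<psi> M"
    by (rule sgn_match_cong_zeros[OF iso \<psi>(1) M \<psi>Z[unfolded Z_def]])
  interpret c: sgn_matched "\<lambda>t. t" \<psi> Z p q
    by (rule matched[OF \<psi>(1) \<psi>M \<psi>Z])
  have roots: "poly p t = 0 \<longleftrightarrow> poly q (\<psi> t) = 0" for t
  proof (cases "t \<in> Z")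
    case True
    then show ?thesis using c.sgn_Z by (metis sgn_0_0)
  next
    case False
    show ?thesis
    proof
      assume "poly p t = 0"
      then have "t \<in> A" by (simp add: A_def)
      then show "poly q (\<psi> t) = 0" using bspec[OF \<psi>(2)] g(2)[OF _ False] by simp
    next
      assume q0: "poly q (\<psi> t) = 0"
      \<comment> \<open>As \<open>\<psi>\<close> and \<open>\<phi>\<close> agree on
        \<open>Z\<close>, \<open>s\<close> shares the component of \<open>t\<close>. A root
        \<open>\<rho>\<close> of \<open>p\<close> there has \<open>g \<rho> = s\<close> by
        uniqueness of the root of \<open>q\<close>, hence \<open>\<psi> \<rho> = \<psi> t\<close>
        and \<open>\<rho> = t\<close>.\<close>
      obtain s where s: "\<psi> t = \<phi> s" using order_iso_surj iso by blast
      have "z < t \<longleftrightarrow> z < s" "t < z \<longleftrightarrow> s < z" if "z \<in> Z" for z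
        using that \<psi>Z s order_iso_less[OF \<psi>(1), of z t] order_iso_less[OF \<psi>(1), of t z]
          order_iso_less[OF iso, of z s] order_iso_less[OF iso, of s z] by auto
      then have ts: "same_comp Z t s"
        using False unfolding same_comp_def
        by (auto simp: min_def max_def order_le_less split: if_splits)
      obtain \<rho> where \<rho>: "same_comp Z s \<rho>" "poly p \<rho> = 0"
        using b.root_exists[of s] q0 s ts same_comp_notin by auto
      have \<rho>A: "\<rho> \<in> A" "\<rho> \<notin> Z" using \<rho> same_comp_notin by (auto simp: A_def)
      then have "same_comp Z s (g \<rho>)" using g \<rho> same_comp_trans by blast
      then have "s = g \<rho>" using b.root_unique q0 s g(2)[OF \<rho>A] by simp
      then have "\<psi> \<rho> = \<psi> t" using \<psi> \<rho>A s by simp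
      then show "poly p t = 0" using \<rho> \<psi> by simp
    qed
  qed
  have "sgn (poly p t) = sgn (poly q (\<psi> t))" for t
    using c.sgn_eq roots by blast
  then have "sgn_match \<psi> (insert (p, q) M)" using \<psi>M by (simp add: sgn_match_def)
  then show ?thesis using \<psi>(1) \<psi>Z by (auto simp: Z_def)
qed

section \<open>Polynomials with parameters\<close>

text \<open>The ring supplies coefficients that depend on a parameter \<open>x\<close>; later it is
  \<open>polyfuns (V - {v})\<close> with \<open>v\<close> as the indeterminate. Demanding only
  rational constants keeps all constructions over the rationals.\<close>

locale function_ring =
  fixes A :: "('x \<Rightarrow> real) set"
  assumes const: "c \<in> \<rat> \<Longrightarrow> (\<lambda>_. c) \<in> A"
    and add: "f \<in> A \<Longrightarrow> g \<in> A \<Longrightarrow> (\<lambda>x. f x + g x) \<in> A"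
    and mult: "f \<in> A \<Longrightarrow> g \<in> A \<Longrightarrow> (\<lambda>x. f x * g x) \<in> A"
begin

lemma diff: "f \<in> A \<Longrightarrow> g \<in> A \<Longrightarrow> (\<lambda>x. f x - g x) \<in> A"
  using add[of f "\<lambda>x. (- 1) * g x"] mult[of "\<lambda>_. - 1" g] const[of "- 1"] by simp

lemma sum: "(\<And>i. i \<in> I \<Longrightarrow> f i \<in> A) \<Longrightarrow> (\<lambda>x. \<Sum>i\<in>I. f i x) \<in> A"
  by (induction I rule: infinite_finite_induct) (auto intro: const add)

lemma prod: "(\<And>i. i \<in> I \<Longrightarrow> f i \<in> A) \<Longrightarrow> (\<lambda>x. \<Prod>i\<in>I. f i x) \<in> A"
  by (induction I rule: infinite_finite_induct) (auto intro: const mult)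

lemma power: "f \<in> A \<Longrightarrow> (\<lambda>x. f x ^ n) \<in> A"
  by (induction n) (auto intro: const mult)

text \<open>The bound \<open>n\<close> is uniform in \<open>x\<close> and formal: the coefficient at
  \<open>n\<close> may vanish for some or all parameters.\<close>

definition polys :: "nat \<Rightarrow> ('x \<Rightarrow> real poly) set" where
  "polys n = {p. (\<forall>i. (\<lambda>x. coeff (p x) i) \<in> A) \<and> (\<forall>x. degree (p x) \<le> n)}"

lemma coeff_polys: "p \<in> polys n \<Longrightarrow> (\<lambda>x. coeff (p x) i) \<in> A"
  by (simp add: polys_def)

lemma degree_polys: "p \<in> polys n \<Longrightarrow> degree (p x) \<le> n"
  by (simp add: polys_def)

lemma polys_mono: "p \<in> polys m \<Longrightarrow> m \<le> n \<Longrightarrow> p \<in> polys n"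
  by (auto simp: polys_def intro: order_trans)

lemma polysI:
  "(\<And>i. (\<lambda>x. coeff (p x) i) \<in> A) \<Longrightarrow> (\<And>x i. i > n \<Longrightarrow> coeff (p x) i = 0) \<Longrightarrow> p \<in> polys n"
  by (auto simp: polys_def intro: degree_le)

lemma polys_const: "f \<in> A \<Longrightarrow> (\<lambda>x. [:f x:]) \<in> polys 0"
proof (rule polysI)
  fix i assume "f \<in> A"
  then show "(\<lambda>x. coeff [:f x:] i) \<in> A" using const[of 0] by (cases i) simp_all
qed (simp add: coeff_pCons split: nat.split)

lemma polys_var: "(\<lambda>_. [:0, 1:]) \<in> polys 1"
  by (intro polysI const) (auto simp: coeff_pCons split: nat.split)

lemma polys_add: "p \<in> polys m \<Longrightarrow> q \<in> polys n \<Longrightarrow> (\<lambda>x. p x + q x) \<in> polys (max m n)"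
  by (auto simp: polys_def intro!: add degree_add_le intro: max.coboundedI1 max.coboundedI2)

lemma polys_mult:
  assumes "p \<in> polys m" "q \<in> polys n"
  shows "(\<lambda>x. p x * q x) \<in> polys (m + n)"
proof -
  have "(\<lambda>x. coeff (p x * q x) i) \<in> A" for i
    unfolding coeff_mult by (intro sum mult coeff_polys[OF assms(1)] coeff_polys[OF assms(2)])
  moreover have "degree (p x * q x) \<le> m + n" for x
    using degree_mult_le[of "p x" "q x"] degree_polys[OF assms(1), of x] degree_polys[OF assms(2), of x]
    by linarith
  ultimately show ?thesis by (simp add: polys_def)
qed

text \<open>At parameters where the coefficient at \<open>n\<close> vanishes this is still
  \<open>p x\<close>, but its formal degree has dropped.\<close>

definition trunc :: "nat \<Rightarrow> ('x \<Rightarrow> real poly) \<Rightarrow> 'x \<Rightarrow> real poly" where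
  "trunc n p = (\<lambda>x. p x - monom (coeff (p x) n) n)"

lemma trunc_polys:
  assumes "p \<in> polys (Suc n)"
  shows "trunc (Suc n) p \<in> polys n"
proof (rule polysI)
  fix i
  have "(\<lambda>x. coeff (trunc (Suc n) p x) i) =
      (if i = Suc n then (\<lambda>_. 0) else (\<lambda>x. coeff (p x) i))"
    by (auto simp: trunc_def)
  then show "(\<lambda>x. coeff (trunc (Suc n) p x) i) \<in> A"
    using coeff_polys[OF assms] const[of 0] by simp
next
  fix x i assume "n < i"
  then show "coeff (trunc (Suc n) p x) i = 0"
    using degree_polys[OF assms, of x] by (auto simp: trunc_def coeff_eq_0)
qed

lemma pderiv_polys:
  assumes "p \<in> polys (Suc n)"
  shows "(\<lambda>x. pderiv (p x)) \<in> polys n"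
proof (rule polysI)
  fix i
  show "(\<lambda>x. coeff (pderiv (p x)) i) \<in> A"
    using mult[OF const[of "of_nat (Suc i)"] coeff_polys[OF assms]] by (simp add: coeff_pderiv)
next
  fix x i assume "n < i"
  then show "coeff (pderiv (p x)) i = 0"
    using degree_polys[OF assms, of x] by (simp add: coeff_pderiv coeff_eq_0)
qed

text \<open>Division with remainder without inverting the leading coefficient, whence its power.
  Only values at roots of \<open>q x\<close> are recorded, so no quotient appears.\<close>

lemma pseudo_remainder:
  assumes q: "q \<in> polys (Suc m)" and p: "p \<in> polys n"
  shows "\<exists>r\<in>polys m. \<exists>j. \<forall>x t. poly (q x) t = 0 \<longrightarrow>
    coeff (q x) (Suc m) ^ j * poly (p x) t = poly (r x) t"
  using p
proof (induction n arbitrary: p)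
  case 0
  then show ?case using polys_mono[of p 0 m] by (intro bexI[of _ p] exI[of _ 0]) auto
next
  case (Suc n)
  show ?case
  proof (cases "Suc n \<le> m")
    case True
    then show ?thesis using polys_mono Suc.prems by (intro bexI[of _ p] exI[of _ 0]) auto
  next
    case False
    \<comment> \<open>The coefficients at \<open>Suc n\<close> cancel, as \<open>m \<le> n\<close>
      here; at a root of \<open>q x\<close> the subtracted product vanishes and one more factor of
      the leading coefficient remains.\<close>
    define p' where "p' = (\<lambda>x. smult (coeff (q x) (Suc m)) (p x)
      - monom (coeff (p x) (Suc n)) (n - m) * q x)"
    have "p' \<in> polys n"
    proof (rule polysI)
      fix i
      show "(\<lambda>x. coeff (p' x) i) \<in> A"
        using diff[OF mult[OF coeff_polys[OF q] coeff_polys[OF Suc.prems]]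
            mult[OF coeff_polys[OF Suc.prems] coeff_polys[OF q]]]
          mult[OF coeff_polys[OF q] coeff_polys[OF Suc.prems]]
        by (cases "n - m \<le> i") (simp_all add: p'_def coeff_monom_mult)
    next
      fix x i assume i: "n < i"
      show "coeff (p' x) i = 0"
      proof (cases "i = Suc n")
        case True
        then have "i - (n - m) = Suc m" using False by simp
        then show ?thesis using True by (simp add: p'_def coeff_monom_mult)
      next
        case neq: False
        then have "i - (n - m) > Suc m" using False i by simp
        then show ?thesis
          using neq i degree_polys[OF q, of x] degree_polys[OF Suc.prems, of x]
          by (simp add: p'_def coeff_monom_mult coeff_eq_0)
      qed
    qed
    then obtain r j where r: "r \<in> polys m" "\<forall>x t. poly (q x) t = 0 \<longrightarrow>
        coeff (q x) (Suc m) ^ j * poly (p' x) t = poly (r x) t"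
      using Suc.IH by blast
    have "coeff (q x) (Suc m) ^ Suc j * poly (p x) t = poly (r x) t" if "poly (q x) t = 0" for x t
      using r(2) that by (auto simp: p'_def ac_simps)
    then show ?thesis using r(1) by blast
  qed
qed

text \<open>The auxiliary family \<open>U\<close> makes the induction on the degree bound \<open>N\<close> work: a polynomial of degree \<open>N\<close>
  can only be added to the matched ones if its signs at the roots of all polynomials of lower degree
  are matched already. At a root of \<open>p\<close> the sign of \<open>u\<close> is that of its pseudo-remainder by \<open>p\<close>, up to the
  sign of a power of the leading coefficient.\<close>

lemma finite_sign_determination:
  assumes "finite P" "P \<subseteq> polys N" "finite U" "\<forall>u\<in>U. \<exists>n. u \<in> polys n"
  shows "\<exists>G. finite G \<and> G \<subseteq> A \<and> (\<forall>x y. (\<forall>g\<in>G. sgn (g x) = sgn (g y)) \<longrightarrow>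
    (\<exists>\<phi>. order_iso \<phi> \<and> (\<forall>p\<in>P. \<forall>t. sgn (poly (p x) t) = sgn (poly (p y) (\<phi> t))) \<and>
      (\<forall>p\<in>P. \<forall>u\<in>U. \<forall>t. p x \<noteq> 0 \<and> poly (p x) t = 0 \<longrightarrow>
         sgn (poly (u x) t) = sgn (poly (u y) (\<phi> t)))))"
  using assms
proof (induction N arbitrary: P U)
  case 0
  have const: "p x = [:coeff (p x) 0:]" if "p \<in> P" for p x
  proof -
    have "degree (p x) = 0" using 0 that degree_polys[of p 0 x] by auto
    then show ?thesis using degree_0_id[of "p x"] by simp
  qed
  \<comment> \<open>All polynomials are constant: the signs of the constants suffice, the identity
    serves as \<open>\<phi>\<close>, and a nonzero constant has no roots, so nothing is asked of
    \<open>U\<close>.\<close>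
  show ?case
  proof (intro exI[of _ "(\<lambda>p x. coeff (p x) 0) ` P"] conjI allI impI)
    fix x y assume eq: "\<forall>g\<in>(\<lambda>p x. coeff (p x) 0) ` P. sgn (g x) = sgn (g y)"
    have "sgn (poly (p x) t) = sgn (poly (p y) t)" if "p \<in> P" for p t
    proof -
      have "sgn (coeff (p x) 0) = sgn (coeff (p y) 0)" using eq that by (auto dest: bspec)
      then show ?thesis by (subst (1 2) const[OF that]) simp
    qed
    moreover have False if "p \<in> P" "p x \<noteq> 0" "poly (p x) t = 0" for p t
    proof -
      have "poly [:coeff (p x) 0:] t = 0" using that(3) const[OF that(1), of x] by simp
      then have "coeff (p x) 0 = 0" by simp
      then show False using that(2) const[OF that(1), of x] by (metis pCons_0_0)
    qed
    ultimately show "\<exists>\<phi>. order_iso \<phi> \<and> (\<forall>p\<in>P. \<forall>t. sgn (poly (p x) t) = sgn (poly (p y) (\<phi> t))) \<and>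
      (\<forall>p\<in>P. \<forall>u\<in>U. \<forall>t. p x \<noteq> 0 \<and> poly (p x) t = 0 \<longrightarrow>
         sgn (poly (u x) t) = sgn (poly (u y) (\<phi> t)))"
      using order_iso_id by (intro exI[of _ "\<lambda>t. t"] conjI) blast+
  qed (use 0 coeff_polys in auto)
next
  case (Suc N)
  have "\<exists>rj. fst rj \<in> polys N \<and> (\<forall>x t. poly (snd k x) t = 0 \<longrightarrow>
      coeff (snd k x) (Suc N) ^ snd rj * poly (fst k x) t = poly (fst rj x) t)"
    if k: "k \<in> (U \<union> P) \<times> P" for k
  proof -
    obtain n where "fst k \<in> polys n" using k Suc.prems by fastforce
    moreover have "snd k \<in> polys (Suc N)" using k Suc.prems by auto
    ultimately obtain r j where "r \<in> polys N" "\<forall>x t. poly (snd k x) t = 0 \<longrightarrow>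
        coeff (snd k x) (Suc N) ^ j * poly (fst k x) t = poly (r x) t"
      using pseudo_remainder by blast
    then show ?thesis by (intro exI[of _ "(r, j)"]) simp
  qed
  then have "\<forall>k\<in>(U \<union> P) \<times> P. \<exists>rj. fst rj \<in> polys N \<and> (\<forall>x t. poly (snd k x) t = 0 \<longrightarrow>
      coeff (snd k x) (Suc N) ^ snd rj * poly (fst k x) t = poly (fst rj x) t)"
    by blast
  from bchoice[OF this] obtain RJ where RJ: "\<forall>k\<in>(U \<union> P) \<times> P. fst (RJ k) \<in> polys N \<and>
      (\<forall>x t. poly (snd k x) t = 0 \<longrightarrow>
        coeff (snd k x) (Suc N) ^ snd (RJ k) * poly (fst k x) t = poly (fst (RJ k) x) t)" ..
  define R where "R = (\<lambda>u p. fst (RJ (u, p)))"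
  define J where "J = (\<lambda>u p. snd (RJ (u, p)))"
  have R: "R u p \<in> polys N"
      "poly (p x) t = 0 \<Longrightarrow> coeff (p x) (Suc N) ^ J u p * poly (u x) t = poly (R u p x) t"
    if "u \<in> U \<union> P" "p \<in> P" for u p x t
    using bspec[OF RJ, of "(u, p)"] that by (simp_all add: R_def J_def)
  \<comment> \<open>Truncations replace members of \<open>P\<close> whose leading coefficient
    vanishes, derivatives control monotonicity, and remainders give signs at roots of members of
    \<open>P\<close>.\<close>
  define L where "L = trunc (Suc N) ` P \<union> (\<lambda>p x. pderiv (p x)) ` P
    \<union> (\<lambda>(u, p). R u p) ` ((U \<union> P) \<times> P)"
  have "finite L" "L \<subseteq> polys N"
    using Suc.prems trunc_polys pderiv_polys R(1) by (auto simp: L_def)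
  \<comment> \<open>\<open>P\<close> joins the auxiliary family, so that its signs at the zeros of
    \<open>L\<close> are matched, as \<open>sgn_match_extend\<close> will ask.\<close>
  moreover have "\<forall>u\<in>U \<union> P. \<exists>n. u \<in> polys n" using Suc.prems by blast
  ultimately obtain G where G: "finite G" "G \<subseteq> A" and "\<forall>x y. (\<forall>g\<in>G. sgn (g x) = sgn (g y)) \<longrightarrow>
    (\<exists>\<phi>. order_iso \<phi> \<and> (\<forall>p\<in>L. \<forall>t. sgn (poly (p x) t) = sgn (poly (p y) (\<phi> t))) \<and>
      (\<forall>p\<in>L. \<forall>u\<in>U \<union> P. \<forall>t. p x \<noteq> 0 \<and> poly (p x) t = 0 \<longrightarrow>
         sgn (poly (u x) t) = sgn (poly (u y) (\<phi> t))))"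
    using Suc.IH[of L "U \<union> P"] Suc.prems by (auto simp del: ball_Un)
  note IH = this(3)[rule_format]
  show ?case
  \<comment> \<open>The leading coefficients decide which members of \<open>P\<close> truly have
    degree \<open>Suc N\<close>, and their signs translate signs of pseudo-remainders into signs of
    the polynomials divided.\<close>
  proof (intro exI[of _ "G \<union> (\<lambda>p x. coeff (p x) (Suc N)) ` P"] conjI allI impI)
    fix x y
    assume eq: "\<forall>g\<in>G \<union> (\<lambda>p x. coeff (p x) (Suc N)) ` P. sgn (g x) = sgn (g y)"
    then obtain \<phi> where \<phi>: "order_iso \<phi>"
      and \<phi>L: "\<And>p t. p \<in> L \<Longrightarrow> sgn (poly (p x) t) = sgn (poly (p y) (\<phi> t))"
      and \<phi>U: "\<And>p u t. p \<in> L \<Longrightarrow> u \<in> U \<union> P \<Longrightarrow> p x \<noteq> 0 \<Longrightarrow> poly (p x) t = 0 \<Longrightarrow>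
         sgn (poly (u x) t) = sgn (poly (u y) (\<phi> t))"
      using IH[of x y] by blast
    have lc: "sgn (coeff (p x) (Suc N)) = sgn (coeff (p y) (Suc N))" if "p \<in> P" for p
      using bspec[OF eq, of "\<lambda>x. coeff (p x) (Suc N)"] that by blast
    define pair where "pair = (\<lambda>p. (p x, p y) :: real poly \<times> real poly)"
    define M where "M = pair ` L"
    define P' where "P' = {p \<in> P. coeff (p x) (Suc N) \<noteq> 0}"
    have remainder: "sgn (poly (u x) t) = sgn (poly (u y) (\<psi> t))"
      if \<psi>: "sgn_match \<psi> (M \<union> pair ` Q)" "p \<in> Q" and p: "p \<in> P'" "u \<in> U \<union> P" "poly (p x) t = 0"
      for \<psi> Q p u t
    proof -
      have "p \<in> P" using p by (simp add: P'_def)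
      have "sgn (poly (p x) t) = sgn (poly (p y) (\<psi> t))"
        using \<psi> by (auto simp: sgn_match_def pair_def)
      then have "poly (p y) (\<psi> t) = 0" using p by (simp add: sgn_zero_iff)
      moreover have "R u p \<in> L" using p \<open>p \<in> P\<close> by (auto simp: L_def)
      then have "sgn (poly (R u p x) t) = sgn (poly (R u p y) (\<psi> t))"
        using \<psi> by (auto simp: sgn_match_def M_def pair_def)
      ultimately have "sgn (coeff (p x) (Suc N) ^ J u p * poly (u x) t) =
          sgn (coeff (p y) (Suc N) ^ J u p * poly (u y) (\<psi> t))"
        using R(2)[OF p(2) \<open>p \<in> P\<close>] p(3) by simp
      then show ?thesis using lc[OF \<open>p \<in> P\<close>] p(1) by (auto simp: sgn_mult power_sgn P'_def sgn_zero_iff)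
    qed
    \<comment> \<open>The members of \<open>P'\<close> are added one at a time. Each new map still
      agrees with \<open>\<phi>\<close> on \<open>zeros M\<close>, so \<open>\<phi>U\<close> remains
      usable.\<close>
    have "\<exists>\<psi>. order_iso \<psi> \<and> sgn_match \<psi> (M \<union> pair ` Q) \<and> (\<forall>z\<in>zeros M. \<psi> z = \<phi> z)"
      if "finite Q" "Q \<subseteq> P'" for Q
      using that
    proof (induction Q rule: finite_induct)
      case empty
      have "sgn_match \<phi> M" using \<phi>L by (auto simp: sgn_match_def M_def pair_def)
      then show ?case using \<phi> by auto
    next
      case (insert p Q)
      then obtain \<psi> where \<psi>: "order_iso \<psi>" "sgn_match \<psi> (M \<union> pair ` Q)" "\<forall>z\<in>zeros M. \<psi> z = \<phi> z"
        by auto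
      have p: "p \<in> P" "coeff (p x) (Suc N) \<noteq> 0" using insert by (auto simp: P'_def)
      have "\<exists>\<chi>. order_iso \<chi> \<and> sgn_match \<chi> (insert (p x, p y) (M \<union> pair ` Q)) \<and>
          (\<forall>z\<in>zeros (M \<union> pair ` Q). \<chi> z = \<psi> z)"
      proof (rule sgn_match_extend)
        show "finite (M \<union> pair ` Q)" using insert \<open>finite L\<close> by (simp add: M_def)
        show "(pderiv (p x), pderiv (p y)) \<in> M \<union> pair ` Q"
          using p by (auto simp: M_def L_def pair_def image_iff)
        show "pderiv (p x) \<noteq> 0" using p le_degree[of "p x" "Suc N"] by (auto simp: pderiv_eq_0_iff)
        show "\<forall>z\<in>zeros (M \<union> pair ` Q). sgn (poly (p x) z) = sgn (poly (p y) (\<psi> z))"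
        proof
          fix z assume "z \<in> zeros (M \<union> pair ` Q)"
          \<comment> \<open>At a zero of a member of \<open>L\<close> the sign of \<open>p\<close>
            is matched by the induction hypothesis, at a root of an already added \<open>q\<close>
            by the remainder of \<open>p\<close> modulo \<open>q\<close>.\<close>
          then consider l where "l \<in> L" "l x \<noteq> 0" "poly (l x) z = 0"
            | q where "q \<in> Q" "poly (q x) z = 0"
            by (auto simp: zeros_def M_def pair_def)
          then show "sgn (poly (p x) z) = sgn (poly (p y) (\<psi> z))"
          proof cases
            case 1
            then have "z \<in> zeros M" by (auto simp: zeros_def M_def pair_def)
            then show ?thesis using \<phi>U 1 p \<psi> by simp
          next
            case 2
            then show ?thesis using remainder[OF \<psi>(2)] insert p by auto
          qed
        qed
      qed (use \<psi> in auto)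
      then obtain \<chi> where "order_iso \<chi>" "sgn_match \<chi> (insert (p x, p y) (M \<union> pair ` Q))"
          "\<forall>z\<in>zeros (M \<union> pair ` Q). \<chi> z = \<psi> z"
        by blast
      moreover have "zeros M \<subseteq> zeros (M \<union> pair ` Q)" by (auto simp: zeros_def)
      ultimately show ?case using \<psi>(3) by (intro exI[of _ \<chi>]) (auto simp: pair_def)
    qed
    from this[of P'] obtain \<psi> where \<psi>: "order_iso \<psi>" "sgn_match \<psi> (M \<union> pair ` P')"
        "\<forall>z\<in>zeros M. \<psi> z = \<phi> z"
      using Suc.prems by (auto simp: P'_def)
    have lower: "trunc (Suc N) p \<in> L" "trunc (Suc N) p x = p x" "trunc (Suc N) p y = p y"
      if "p \<in> P" "p \<notin> P'" for p
      using that lc[OF that(1)] by (auto simp: L_def trunc_def P'_def sgn_zero_iff)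
    have "sgn (poly (p x) t) = sgn (poly (p y) (\<psi> t))" if "p \<in> P" for p t
    proof (cases "p \<in> P'")
      case True
      then show ?thesis using \<psi>(2) by (auto simp: sgn_match_def pair_def)
    next
      case False
      note l = lower[OF that False]
      have "pair p = pair (trunc (Suc N) p)" using l by (simp add: pair_def)
      then have "pair p \<in> M" using l(1) by (simp add: M_def)
      then show ?thesis using \<psi>(2) by (auto simp: sgn_match_def pair_def)
    qed
    moreover have "sgn (poly (u x) t) = sgn (poly (u y) (\<psi> t))"
      if "p \<in> P" "u \<in> U" "p x \<noteq> 0" "poly (p x) t = 0" for p u t
    proof (cases "p \<in> P'")
      case True
      then show ?thesis using remainder[OF \<psi>(2)] that by auto
    next
      case False
      note l = lower[OF that(1) False]
      have "pair (trunc (Suc N) p) \<in> M" using l(1) by (simp add: M_def)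
      then have "t \<in> zeros M" using l(2) that by (auto simp: zeros_def pair_def)
      then show ?thesis using \<phi>U[OF l(1)] l that \<psi>(3) by simp
    qed
    ultimately show "\<exists>\<phi>. order_iso \<phi> \<and> (\<forall>p\<in>P. \<forall>t. sgn (poly (p x) t) = sgn (poly (p y) (\<phi> t))) \<and>
      (\<forall>p\<in>P. \<forall>u\<in>U. \<forall>t. p x \<noteq> 0 \<and> poly (p x) t = 0 \<longrightarrow>
         sgn (poly (u x) t) = sgn (poly (u y) (\<phi> t)))"
      using \<psi>(1) by blast
  qed (use G Suc.prems coeff_polys in auto)
qed

corollary sign_determination:
  assumes "finite P" "P \<subseteq> polys N"
  shows "\<exists>G. finite G \<and> G \<subseteq> A \<and> (\<forall>x y. (\<forall>g\<in>G. sgn (g x) = sgn (g y)) \<longrightarrow>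
    (\<exists>\<phi>. order_iso \<phi> \<and> (\<forall>p\<in>P. \<forall>t. sgn (poly (p x) t) = sgn (poly (p y) (\<phi> t)))))"
  using finite_sign_determination[OF assms finite.emptyI] by simp

end

section \<open>Projection of semialgebraic sets\<close>

text \<open>Polynomials are taken as functions on all assignments, and \<open>V\<close> only
  restricts the variables used. Eliminating a variable therefore changes \<open>V\<close> but not
  the type.\<close>

inductive_set polyfuns :: "'i set \<Rightarrow> (('i \<Rightarrow> real) \<Rightarrow> real) set" for V where
  const: "c \<in> \<rat> \<Longrightarrow> (\<lambda>_. c) \<in> polyfuns V"
| var: "i \<in> V \<Longrightarrow> (\<lambda>x. x i) \<in> polyfuns V"
| add: "f \<in> polyfuns V \<Longrightarrow> g \<in> polyfuns V \<Longrightarrow> (\<lambda>x. f x + g x) \<in> polyfuns V"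
| mult: "f \<in> polyfuns V \<Longrightarrow> g \<in> polyfuns V \<Longrightarrow> (\<lambda>x. f x * g x) \<in> polyfuns V"

lemma function_ring_polyfuns: "function_ring (polyfuns V)"
  by unfold_locales (rule polyfuns.intros; assumption)+

lemmas polyfuns_diff = function_ring.diff[OF function_ring_polyfuns]
lemmas polyfuns_sum = function_ring.sum[OF function_ring_polyfuns]
lemmas polyfuns_prod = function_ring.prod[OF function_ring_polyfuns]
lemmas polyfuns_power = function_ring.power[OF function_ring_polyfuns]

lemma polyfuns_empty: "f \<in> polyfuns {} \<Longrightarrow> \<exists>c\<in>\<rat>. f = (\<lambda>_. c)"
  by (induction rule: polyfuns.induct) auto

lemma polyfuns_as_poly:
  assumes "f \<in> polyfuns V"
  shows "\<exists>n. \<exists>p\<in>function_ring.polys (polyfuns (V - {v})) n. \<forall>x t. f (x(v := t)) = poly (p x) t"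
  using assms
proof (induction rule: polyfuns.induct)
  interpret function_ring "polyfuns (V - {v})" by (rule function_ring_polyfuns)
  {
    case (const c)
    show ?case
      using polys_const[OF polyfuns.const[OF const]] by (intro exI[of _ 0] bexI[of _ "\<lambda>_. [:c:]"]) auto
  next
    case (var i)
    show ?case
    proof (cases "i = v")
      case True
      then show ?thesis using polys_var by (intro exI[of _ 1] bexI[of _ "\<lambda>_. [:0, 1:]"]) auto
    next
      case False
      then have "(\<lambda>x. [:x i:]) \<in> polys 0" using var by (intro polys_const polyfuns.var) auto
      then show ?thesis using False by (intro exI[of _ 0] bexI[of _ "\<lambda>x. [:x i:]"]) auto
    qed
  next
    case (add f g)
    then obtain m n p q where "p \<in> polys m" "\<forall>x t. f (x(v := t)) = poly (p x) t"
        "q \<in> polys n" "\<forall>x t. g (x(v := t)) = poly (q x) t"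
      by blast
    then show ?case using polys_add[of p m q n]
      by (intro exI[of _ "max m n"] bexI[of _ "\<lambda>x. p x + q x"]) (auto simp del: fun_upd_apply)
  next
    case (mult f g)
    then obtain m n p q where "p \<in> polys m" "\<forall>x t. f (x(v := t)) = poly (p x) t"
        "q \<in> polys n" "\<forall>x t. g (x(v := t)) = poly (q x) t"
      by blast
    then show ?case using polys_mult[of p m q n]
      by (intro exI[of _ "m + n"] bexI[of _ "\<lambda>x. p x * q x"]) (auto simp del: fun_upd_apply)
  }
qed

text \<open>These are the semialgebraic sets over \<open>\<rat>\<close> in the variables \<open>V\<close>: finite unions of sign classes.\<close>

definition sign_definable :: "'i set \<Rightarrow> ('i \<Rightarrow> real) set \<Rightarrow> bool" where
  "sign_definable V S \<longleftrightarrow> (\<exists>G. finite G \<and> G \<subseteq> polyfuns V \<and>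
     (\<forall>x y. (\<forall>g\<in>G. sgn (g x) = sgn (g y)) \<longrightarrow> (x \<in> S \<longleftrightarrow> y \<in> S)))"

lemma sign_definableI:
  assumes "f \<in> polyfuns V" "\<And>x y. sgn (f x) = sgn (f y) \<Longrightarrow> x \<in> S \<longleftrightarrow> y \<in> S"
  shows "sign_definable V S"
  unfolding sign_definable_def using assms by (intro exI[of _ "{f}"]) blast

lemma sign_definable_nonneg:
  assumes "f \<in> polyfuns V"
  shows "sign_definable V {x. f x \<ge> 0}"
proof (rule sign_definableI[OF assms])
  fix x y assume "sgn (f x) = sgn (f y)"
  then show "x \<in> {x. 0 \<le> f x} \<longleftrightarrow> y \<in> {x. 0 \<le> f x}" by (auto simp: sgn_if split: if_splits)
qed

lemma sign_definable_pos:
  assumes "f \<in> polyfuns V"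
  shows "sign_definable V {x. f x > 0}"
proof (rule sign_definableI[OF assms])
  fix x y assume "sgn (f x) = sgn (f y)"
  then show "x \<in> {x. 0 < f x} \<longleftrightarrow> y \<in> {x. 0 < f x}" by (auto simp: sgn_if split: if_splits)
qed

lemma sign_definable_zero:
  assumes "f \<in> polyfuns V"
  shows "sign_definable V {x. f x = 0}"
proof (rule sign_definableI[OF assms])
  fix x y assume "sgn (f x) = sgn (f y)"
  then show "x \<in> {x. f x = 0} \<longleftrightarrow> y \<in> {x. f x = 0}" by (auto simp: sgn_if split: if_splits)
qed

lemma sign_definable_Not:
  assumes "sign_definable V {x. P x}"
  shows "sign_definable V {x. \<not> P x}"
proof -
  obtain G where G: "finite G" "G \<subseteq> polyfuns V"
      "\<And>x y. (\<forall>g\<in>G. sgn (g x) = sgn (g y)) \<Longrightarrow> (x \<in> {x. P x} \<longleftrightarrow> y \<in> {x. P x})"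
    using assms unfolding sign_definable_def by blast
  have "x \<in> {x. \<not> P x} \<longleftrightarrow> y \<in> {x. \<not> P x}" if "\<forall>g\<in>G. sgn (g x) = sgn (g y)" for x y
    using G(3)[OF that] by simp
  then show ?thesis unfolding sign_definable_def using G(1,2) by (intro exI[of _ G]) blast
qed

lemma sign_definable_UNIV: "sign_definable V UNIV"
  unfolding sign_definable_def by auto

lemma sign_definable_conj:
  assumes "sign_definable V {x. P x}" "sign_definable V {x. Q x}"
  shows "sign_definable V {x. P x \<and> Q x}"
proof -
  obtain G where G: "finite G" "G \<subseteq> polyfuns V"
      "\<And>x y. (\<forall>g\<in>G. sgn (g x) = sgn (g y)) \<Longrightarrow> (x \<in> {x. P x} \<longleftrightarrow> y \<in> {x. P x})"
    using assms(1) unfolding sign_definable_def by blast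
  obtain H where H: "finite H" "H \<subseteq> polyfuns V"
      "\<And>x y. (\<forall>g\<in>H. sgn (g x) = sgn (g y)) \<Longrightarrow> (x \<in> {x. Q x} \<longleftrightarrow> y \<in> {x. Q x})"
    using assms(2) unfolding sign_definable_def by blast
  have "x \<in> {x. P x \<and> Q x} \<longleftrightarrow> y \<in> {x. P x \<and> Q x}"
    if "\<forall>g\<in>G \<union> H. sgn (g x) = sgn (g y)" for x y
    using G(3)[of x y] H(3)[of x y] that by blast
  then show ?thesis
    unfolding sign_definable_def using G(1,2) H(1,2) by (intro exI[of _ "G \<union> H"]) blast
qed

lemma sign_definable_imp:
  assumes "sign_definable V {x. P x}" "sign_definable V {x. Q x}"
  shows "sign_definable V {x. P x \<longrightarrow> Q x}"
  using sign_definable_Not[OF sign_definable_conj[OF assms(1) sign_definable_Not[OF assms(2)]]]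
  by simp

lemma sign_definable_Ball:
  assumes "finite I" "\<And>i. i \<in> I \<Longrightarrow> sign_definable V {x. P i x}"
  shows "sign_definable V {x. \<forall>i\<in>I. P i x}"
  using assms by (induction I rule: finite_induct)
    (simp_all add: sign_definable_UNIV sign_definable_conj)

text \<open>If the signs from \<open>sign_determination\<close> agree at \<open>x\<close> and
  \<open>y\<close>, its order isomorphism carries a witness \<open>t\<close> for \<open>x\<close> to
  the witness \<open>\<phi> t\<close> for \<open>y\<close>.\<close>

lemma sign_definable_ex1:
  assumes "sign_definable V S"
  shows "sign_definable (V - {v}) {x. \<exists>t. x(v := t) \<in> S}"
proof -
  interpret function_ring "polyfuns (V - {v})" by (rule function_ring_polyfuns)
  obtain G where G: "finite G" "G \<subseteq> polyfuns V"
      "\<And>x y. (\<forall>g\<in>G. sgn (g x) = sgn (g y)) \<Longrightarrow> (x \<in> S \<longleftrightarrow> y \<in> S)"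
    using assms unfolding sign_definable_def by blast
  have "\<forall>g\<in>G. \<exists>p. (\<exists>n. p \<in> polys n) \<and> (\<forall>x t. g (x(v := t)) = poly (p x) t)"
  proof
    fix g assume "g \<in> G"
    then have "g \<in> polyfuns V" using G(2) by blast
    from polyfuns_as_poly[OF this, of v]
    show "\<exists>p. (\<exists>n. p \<in> polys n) \<and> (\<forall>x t. g (x(v := t)) = poly (p x) t)" by blast
  qed
  from bchoice[OF this] obtain p where p: "\<forall>g\<in>G. (\<exists>n. p g \<in> polys n) \<and>
      (\<forall>x t. g (x(v := t)) = poly (p g x) t)" ..
  then have "\<forall>g\<in>G. \<exists>n. p g \<in> polys n" by blast
  from bchoice[OF this] obtain n where n: "\<forall>g\<in>G. p g \<in> polys (n g)" ..
  have "p ` G \<subseteq> polys (Max (n ` G))"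
  proof
    fix q assume "q \<in> p ` G"
    then obtain g where g: "g \<in> G" "q = p g" by blast
    then have "n g \<le> Max (n ` G)" using G(1) by simp
    then show "q \<in> polys (Max (n ` G))" using g n polys_mono by blast
  qed
  from sign_determination[OF finite_imageI[OF G(1)] this]
  obtain H where H: "finite H" "H \<subseteq> polyfuns (V - {v})" "\<forall>x y. (\<forall>g\<in>H. sgn (g x) = sgn (g y)) \<longrightarrow>
      (\<exists>\<phi>. order_iso \<phi> \<and> (\<forall>q\<in>p ` G. \<forall>t. sgn (poly (q x) t) = sgn (poly (q y) (\<phi> t))))"
    by (elim exE conjE)
  have half: "\<exists>t. y(v := t) \<in> S" if eq: "\<forall>g\<in>H. sgn (g x) = sgn (g y)" and t: "x(v := t) \<in> S" for x y t
  proof -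
    obtain \<phi> where "\<forall>q\<in>p ` G. \<forall>t. sgn (poly (q x) t) = sgn (poly (q y) (\<phi> t))"
      using mp[OF spec[OF spec[OF H(3), of x], of y] eq] by blast
    then have "\<forall>g\<in>G. sgn (g (x(v := t))) = sgn (g (y(v := \<phi> t)))"
      using p by (simp del: fun_upd_apply)
    from G(3)[OF this] show ?thesis using t by blast
  qed
  have "(\<exists>t. x(v := t) \<in> S) \<longleftrightarrow> (\<exists>t. y(v := t) \<in> S)"
    if eq: "\<forall>g\<in>H. sgn (g x) = sgn (g y)" for x y
  proof -
    have "\<forall>g\<in>H. sgn (g y) = sgn (g x)" using eq by auto
    then show ?thesis using half[OF eq] half[of y x] by blast
  qed
  then show ?thesis unfolding sign_definable_def using H(1,2) by (intro exI[of _ H]) blast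
qed

text \<open>A block of quantified variables is encoded by a point \<open>y\<close> that may differ
  from \<open>x\<close> on \<open>W\<close> only; the variables are eliminated one by one.\<close>

lemma sign_definable_ex:
  assumes "finite W" "sign_definable V S"
  shows "sign_definable (V - W) {x. \<exists>y\<in>S. \<forall>i. i \<notin> W \<longrightarrow> y i = x i}"
  using assms
proof (induction W rule: finite_induct)
  case empty
  have "{x. \<exists>y\<in>S. \<forall>i. i \<notin> {} \<longrightarrow> y i = x i} = S"
    by (simp add: fun_eq_iff[symmetric])
  then show ?case using empty by simp
next
  case (insert w W)
  have "(\<exists>y\<in>S. \<forall>i. i \<notin> insert w W \<longrightarrow> y i = x i) \<longleftrightarrow>
      (\<exists>t. x(w := t) \<in> {x. \<exists>y\<in>S. \<forall>i. i \<notin> W \<longrightarrow> y i = x i})" for x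
  proof
    assume "\<exists>y\<in>S. \<forall>i. i \<notin> insert w W \<longrightarrow> y i = x i"
    then obtain y where y: "y \<in> S" "\<forall>i. i \<notin> insert w W \<longrightarrow> y i = x i" by blast
    then have "\<forall>i. i \<notin> W \<longrightarrow> y i = (x(w := y w)) i" by simp
    then show "\<exists>t. x(w := t) \<in> {x. \<exists>y\<in>S. \<forall>i. i \<notin> W \<longrightarrow> y i = x i}" using y(1) by blast
  next
    assume "\<exists>t. x(w := t) \<in> {x. \<exists>y\<in>S. \<forall>i. i \<notin> W \<longrightarrow> y i = x i}"
    then obtain t y where y: "y \<in> S" "\<forall>i. i \<notin> W \<longrightarrow> y i = (x(w := t)) i" by blast
    then have "\<forall>i. i \<notin> insert w W \<longrightarrow> y i = x i" by simp
    then show "\<exists>y\<in>S. \<forall>i. i \<notin> insert w W \<longrightarrow> y i = x i" using y(1) by blast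
  qed
  then show ?case
    using sign_definable_ex1[OF insert.IH[OF insert.prems], of w]
    by (simp only: Diff_insert[of V w W])
qed

lemma sign_definable_all:
  assumes "finite W" "sign_definable V {x. P x}"
  shows "sign_definable (V - W) {x. \<forall>y. (\<forall>i. i \<notin> W \<longrightarrow> y i = x i) \<longrightarrow> P y}"
proof -
  have "{x. \<forall>y. (\<forall>i. i \<notin> W \<longrightarrow> y i = x i) \<longrightarrow> P y} =
      {x. \<not> (\<exists>y\<in>{y. \<not> P y}. \<forall>i. i \<notin> W \<longrightarrow> y i = x i)}"
    by blast
  then show ?thesis
    using sign_definable_Not[OF sign_definable_ex[OF assms(1) sign_definable_Not[OF assms(2)]]] by simp
qed

section \<open>Algebraic points of definable sets\<close>

lemma algebraic_point_univariate:
  assumes "sign_definable {v} S" "x \<in> S"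
  shows "\<exists>y\<in>S. algebraic (y v)"
proof -
  interpret function_ring "polyfuns ({v} - {v})" by (rule function_ring_polyfuns)
  obtain G where G: "finite G" "G \<subseteq> polyfuns {v}"
      "\<And>x y. (\<forall>g\<in>G. sgn (g x) = sgn (g y)) \<Longrightarrow> (x \<in> S \<longleftrightarrow> y \<in> S)"
    using assms(1) unfolding sign_definable_def by blast
  have "\<exists>q. (\<forall>i. coeff q i \<in> \<rat>) \<and> (\<forall>x. g x = poly q (x v))" if g: "g \<in> G" for g
  proof -
    obtain n p where p: "p \<in> polys n" "\<forall>x t. g (x(v := t)) = poly (p x) t"
      using polyfuns_as_poly[of g "{v}" v] G(2) g by blast
    \<comment> \<open>No variable is left for the coefficients, so they are rational
      constants.\<close>
    have c: "coeff (p y) i = coeff (p x) i \<and> coeff (p x) i \<in> \<rat>" for y i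
    proof -
      have "(\<lambda>x. coeff (p x) i) \<in> polyfuns {}" using coeff_polys[OF p(1), of i] by simp
      from polyfuns_empty[OF this] obtain c where "c \<in> \<rat>" "(\<lambda>x. coeff (p x) i) = (\<lambda>_. c)" by blast
      then show ?thesis using fun_cong[of "\<lambda>x. coeff (p x) i" "\<lambda>_. c" x]
          fun_cong[of "\<lambda>x. coeff (p x) i" "\<lambda>_. c" y] by simp
    qed
    have px: "p y = p x" for y by (rule poly_eqI) (rule conjunct1[OF c])
    have "g y = poly (p x) (y v)" for y using p(2)[rule_format, of y "y v"] px[of y] by simp
    moreover have "coeff (p x) i \<in> \<rat>" for i using c by blast
    ultimately show ?thesis by (intro exI[of _ "p x"]) simp
  qed
  then have "\<forall>g\<in>G. \<exists>q. (\<forall>i. coeff q i \<in> \<rat>) \<and> (\<forall>x. g x = poly q (x v))" by (rule ballI)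
  from bchoice[OF this] obtain q
    where q: "\<forall>g\<in>G. (\<forall>i. coeff (q g) i \<in> \<rat>) \<and> (\<forall>x. g x = poly (q g) (x v))" ..
  \<comment> \<open>Either \<open>x v\<close> is a root of a nonzero rational polynomial and so
    algebraic, or all signs are constant near \<open>x v\<close> and a nearby rational can replace
    it.\<close>
  show ?thesis
  proof (cases "\<exists>g\<in>G. q g \<noteq> 0 \<and> poly (q g) (x v) = 0")
    case True
    then have "algebraic (x v)" unfolding algebraic_altdef using q by blast
    then show ?thesis using assms by blast
  next
    case False
    have "eventually (\<lambda>t. sgn (poly (q g) t) = sgn (poly (q g) (x v))) (nhds (x v))" if "g \<in> G" for g
    proof (cases "q g = 0")
      case False
      have lim: "(poly (q g) \<longlongrightarrow> poly (q g) (x v)) (nhds (x v))"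
        using poly_isCont[of "x v" "q g"]
        by (simp only: isCont_def tendsto_at_iff_tendsto_nhds)
      show ?thesis
      proof (cases "poly (q g) (x v) > 0")
        case True
        show ?thesis using order_tendstoD(1)[OF lim True] by eventually_elim (use True in simp)
      next
        case neg: False
        then have "poly (q g) (x v) < 0"
          using False \<open>\<not> (\<exists>g\<in>G. q g \<noteq> 0 \<and> poly (q g) (x v) = 0)\<close> that
          by (metis linorder_less_linear)
        from order_tendstoD(2)[OF lim this] show ?thesis by eventually_elim (use \<open>poly (q g) (x v) < 0\<close> in simp)
      qed
    qed simp
    then have "eventually (\<lambda>t. \<forall>g\<in>G. sgn (poly (q g) t) = sgn (poly (q g) (x v))) (nhds (x v))"
      using G(1) by (simp add: eventually_ball_finite)
    then obtain d where d: "d > 0"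
        "\<And>t. dist t (x v) < d \<Longrightarrow> \<forall>g\<in>G. sgn (poly (q g) t) = sgn (poly (q g) (x v))"
      unfolding eventually_nhds_metric by blast
    obtain r where r: "r \<in> \<rat>" "x v < r" "r < x v + d"
      using Rats_dense_in_real[of "x v" "x v + d"] d by auto
    then have "dist r (x v) < d" by (simp add: dist_real_def)
    have "\<forall>g\<in>G. sgn (g x) = sgn (g (x(v := r)))"
    proof
      fix g assume "g \<in> G"
      then have *: "g y = poly (q g) (y v)" for y using q by blast
      have "g x = poly (q g) (x v)" "g (x(v := r)) = poly (q g) r"
        using *[of x] *[of "x(v := r)"] by simp_all
      then show "sgn (g x) = sgn (g (x(v := r)))"
        using bspec[OF d(2)[OF \<open>dist r (x v) < d\<close>] \<open>g \<in> G\<close>] by simp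
    qed
    from G(3)[OF this] have "x(v := r) \<in> S" using assms(2) by blast
    then show ?thesis using rat_imp_algebraic[OF r(1)] by (intro bexI[of _ "x(v := r)"]) simp_all
  qed
qed

text \<open>Rational bounds \<open>r\<close> and \<open>s\<close> isolate \<open>a\<close> from the
  other roots of its polynomial, which describes it over the rationals.\<close>

lemma sign_definable_eq_algebraic:
  assumes "algebraic a" "v \<in> V"
  shows "sign_definable V {x. x v = a}"
proof -
  obtain p where p: "\<And>i. coeff p i \<in> \<rat>" "p \<noteq> 0" "poly p a = 0"
    using assms(1) unfolding algebraic_altdef by blast
  have "finite ({t. poly p t = 0} - {a})" using poly_roots_finite[OF p(2)] by (rule finite_Diff)
  then have "open (- ({t. poly p t = 0} - {a}))" by (intro open_Compl finite_imp_closed)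
  moreover have "a \<in> - ({t. poly p t = 0} - {a})" by simp
  ultimately obtain d where d: "d > 0" "\<forall>t. dist t a < d \<longrightarrow> t \<in> - ({t. poly p t = 0} - {a})"
    unfolding open_dist by blast
  obtain r where r: "r \<in> \<rat>" "a - d < r" "r < a" using Rats_dense_in_real[of "a - d" a] d by auto
  obtain s where s: "s \<in> \<rat>" "a < s" "s < a + d" using Rats_dense_in_real[of a "a + d"] d by auto
  have iso: "x v = a \<longleftrightarrow> poly p (x v) = 0 \<and> 0 < x v - r \<and> 0 < s - x v" for x :: "'a \<Rightarrow> real"
  proof
    assume "x v = a"
    then show "poly p (x v) = 0 \<and> 0 < x v - r \<and> 0 < s - x v" using p(3) r s by simp
  next
    assume *: "poly p (x v) = 0 \<and> 0 < x v - r \<and> 0 < s - x v"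
    then have "dist (x v) a < d" using r s by (simp add: dist_real_def abs_less_iff)
    then have "x v \<in> - ({t. poly p t = 0} - {a})" using d(2) by blast
    then show "x v = a" using * by simp
  qed
  have v: "(\<lambda>x. x v) \<in> polyfuns V" using assms(2) by (rule polyfuns.var)
  have "(\<lambda>x. poly p (x v)) \<in> polyfuns V"
    unfolding poly_altdef
    by (intro polyfuns_sum polyfuns.mult polyfuns.const p polyfuns_power v)
  then have "sign_definable V {x. poly p (x v) = 0 \<and> 0 < x v - r \<and> 0 < s - x v}"
    by (intro sign_definable_conj sign_definable_zero sign_definable_pos polyfuns_diff v
        polyfuns.const r s)
  then show ?thesis by (simp only: iso)
qed

lemma algebraic_point:
  assumes "finite V" "sign_definable V S" "S \<noteq> {}"
  shows "\<exists>x\<in>S. \<forall>i\<in>V. algebraic (x i)"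
proof -
  \<comment> \<open>\<open>W\<close> holds the coordinates still to be made algebraic while
    \<open>V\<close> is kept, so that an equation fixing a coordinate remains a condition in the
    variables \<open>V\<close>.\<close>
  have "\<exists>x\<in>S. \<forall>i\<in>W. algebraic (x i)" if "finite W" "W \<subseteq> V" "sign_definable V S" "S \<noteq> {}" for W S
    using that
  proof (induction W arbitrary: S rule: finite_induct)
    case empty
    then show ?case by blast
  next
    case (insert w W)
    have "V - (V - {w}) = {w}" using insert by auto
    then have "sign_definable {w} {x. \<exists>y\<in>S. \<forall>i. i \<notin> V - {w} \<longrightarrow> y i = x i}"
      using sign_definable_ex[OF _ insert.prems(2), of "V - {w}"] assms(1) by simp
    then obtain x where x: "\<exists>y\<in>S. \<forall>i. i \<notin> V - {w} \<longrightarrow> y i = x i" "algebraic (x w)"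
      using algebraic_point_univariate[of w "{x. \<exists>y\<in>S. \<forall>i. i \<notin> V - {w} \<longrightarrow> y i = x i}"]
        insert.prems(3) by blast
    then obtain y where y: "y \<in> S" "algebraic (y w)" by auto
    have "sign_definable V {x. x \<in> S \<and> x w = y w}"
      using insert.prems y by (intro sign_definable_conj sign_definable_eq_algebraic) auto
    then obtain z where "z \<in> S" "z w = y w" "\<forall>i\<in>W. algebraic (z i)"
      using insert.IH[of "{x. x \<in> S \<and> x w = y w}"] insert.prems(1) y(1) by auto
    then show ?case using y(2) by (intro bexI[of _ z]) auto
  qed
  from this[OF assms(1) subset_refl assms(2,3)] show ?thesis .
qed

text \<open>The singleton \<open>{(a, b, f a b)}\<close> is definable, so its only point is algebraic.\<close>

lemma algebraic_binop:
  fixes a b :: real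
  assumes "algebraic a" "algebraic b" "(\<lambda>x. f (x 0) (x 1)) \<in> polyfuns {0, 1, 2 :: nat}"
  shows "algebraic (f a b)"
proof -
  define S where "S = {x :: nat \<Rightarrow> real. x 0 = a \<and> x 1 = b \<and> x 2 - f (x 0) (x 1) = 0}"
  have "sign_definable {0, 1, 2} S"
    unfolding S_def using assms
    by (intro sign_definable_conj sign_definable_eq_algebraic sign_definable_zero polyfuns_diff
        polyfuns.var) auto
  moreover have "(\<lambda>i. if i = 0 then a else if i = 1 then b else f a b) \<in> S" by (simp add: S_def)
  ultimately obtain x where "x \<in> S" "algebraic (x 2)"
    using algebraic_point[of "{0, 1, 2}" S] by auto
  then show ?thesis by (auto simp: S_def)
qed

lemma algebraic_add: "algebraic a \<Longrightarrow> algebraic b \<Longrightarrow> algebraic (a + b :: real)"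
  by (rule algebraic_binop) (auto intro: polyfuns.intros)

lemma algebraic_mult: "algebraic a \<Longrightarrow> algebraic b \<Longrightarrow> algebraic (a * b :: real)"
  by (rule algebraic_binop) (auto intro: polyfuns.intros)

section \<open>From algebraic to real interpretations\<close>

lemma algebraic_sum: "(\<And>i. i \<in> I \<Longrightarrow> algebraic (f i)) \<Longrightarrow> algebraic (\<Sum>i\<in>I. f i :: real)"
  by (induction I rule: infinite_finite_induct) (simp_all add: algebraic_add)

lemma algebraic_prod: "(\<And>i. i \<in> I \<Longrightarrow> algebraic (f i)) \<Longrightarrow> algebraic (\<Prod>i\<in>I. f i :: real)"
  by (induction I rule: infinite_finite_induct) (simp_all add: algebraic_mult)

lemma algebraic_power: "algebraic a \<Longrightarrow> algebraic (a ^ n :: real)"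
  by (induction n) (simp_all add: algebraic_mult)

lemma eval_mpoly_real_alg:
  assumes "p \<in> mpolys real_alg n" "length xs = n" "set xs \<subseteq> real_alg"
  shows "eval_mpoly p xs \<in> real_alg"
proof -
  have "algebraic (xs ! i)" if "i < n" for i
    using that assms(2,3) nth_mem by (fastforce simp: real_alg_def)
  then show ?thesis
    using assms(1) unfolding eval_mpoly_def real_alg_def mpolys_def
    by (auto intro!: algebraic_sum algebraic_mult algebraic_prod algebraic_power)
qed

lemma eval_mpoly_tendsto:
  assumes "p \<in> mpolys D n" "\<And>i. i < n \<Longrightarrow> (\<lambda>k. xs k ! i) \<longlonglongrightarrow> ys ! i"
  shows "(\<lambda>k. eval_mpoly p (xs k)) \<longlonglongrightarrow> eval_mpoly p ys"
  unfolding eval_mpoly_def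
  using assms by (intro tendsto_intros) (auto simp: mpolys_def)

lemma eval_trm_tendsto:
  assumes "wf_trm F ar t" "\<forall>f\<in>F. I f \<in> mpolys D (ar f)" "\<And>x. (\<lambda>k. \<alpha> k x) \<longlonglongrightarrow> \<beta> x"
  shows "(\<lambda>k. eval_trm I (\<alpha> k) t) \<longlonglongrightarrow> eval_trm I \<beta> t"
  using assms(1)
proof (induction t)
  case (Var x)
  then show ?case using assms(3) by simp
next
  case (Fun f ts)
  have "(\<lambda>k. map (eval_trm I (\<alpha> k)) ts ! i) \<longlonglongrightarrow> map (eval_trm I \<beta>) ts ! i" if "i < ar f" for i
    using that Fun by simp
  then show ?case using assms(2) Fun.prems by (auto intro!: eval_mpoly_tendsto)
qed

text \<open>Rounding to multiples of \<open>1 / real (Suc k)\<close> yields rationals and keeps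
  nonnegative numbers nonnegative. Both directions are provided so that a gap of
  \<open>\<delta>\<close> between two numbers survives.\<close>

definition approx_above :: "nat \<Rightarrow> real \<Rightarrow> real" where
  "approx_above k x = of_int \<lceil>x * real (Suc k)\<rceil> / real (Suc k)"

definition approx_below :: "nat \<Rightarrow> real \<Rightarrow> real" where
  "approx_below k x = of_int \<lfloor>x * real (Suc k)\<rfloor> / real (Suc k)"

lemma approx_above_ge: "x \<le> approx_above k x"
  unfolding approx_above_def by (simp add: pos_le_divide_eq del: of_nat_Suc)

lemma approx_below_le: "approx_below k x \<le> x"
  unfolding approx_below_def by (simp add: pos_divide_le_eq del: of_nat_Suc)

lemma approx_nonneg:
  "x \<ge> 0 \<Longrightarrow> approx_above k x \<in> nonneg real_alg"
  "x \<ge> 0 \<Longrightarrow> approx_below k x \<in> nonneg real_alg"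
  using approx_above_ge[of x k]
  by (auto simp: nonneg_def real_alg_def approx_above_def approx_below_def intro!: rat_imp_algebraic)

lemma approx_above_tendsto: "(\<lambda>k. approx_above k x) \<longlonglongrightarrow> x"
proof (rule tendsto_sandwich[where f = "\<lambda>_. x" and h = "\<lambda>k. x + 1 / real (Suc k)"])
  have "approx_above k x \<le> x + 1 / real (Suc k)" for k
    unfolding approx_above_def using of_int_ceiling_le_add_one[of "x * real (Suc k)"]
    by (simp add: divide_simps del: of_nat_Suc)
  then show "eventually (\<lambda>k. approx_above k x \<le> x + 1 / real (Suc k)) sequentially" by simp
  show "(\<lambda>k. x + 1 / real (Suc k)) \<longlonglongrightarrow> x"
    using tendsto_add[OF tendsto_const LIMSEQ_inverse_real_of_nat, of x] by (simp add: inverse_eq_divide)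
qed (simp_all add: approx_above_ge)

lemma approx_below_tendsto: "(\<lambda>k. approx_below k x) \<longlonglongrightarrow> x"
proof (rule tendsto_sandwich[where f = "\<lambda>k. x - 1 / real (Suc k)" and h = "\<lambda>_. x"])
  have "x - 1 / real (Suc k) \<le> approx_below k x" for k
    unfolding approx_below_def using of_int_floor_cancel real_of_int_floor_gt_diff_one[of "x * real (Suc k)"]
    by (simp add: divide_simps del: of_nat_Suc)
  then show "eventually (\<lambda>k. x - 1 / real (Suc k) \<le> approx_below k x) sequentially" by simp
  show "(\<lambda>k. x - 1 / real (Suc k)) \<longlonglongrightarrow> x"
    using tendsto_diff[OF tendsto_const LIMSEQ_inverse_real_of_nat, of x] by (simp add: inverse_eq_divide)
qed (simp_all add: approx_below_le)

lemma polynomially_terminating_real_alg_imp_real: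
  assumes R: "is_trs F ar R" and alg: "polynomially_terminating real_alg F ar R"
  shows "polynomially_terminating UNIV F ar R"
proof -
  obtain \<delta> I where int: "poly_interpretation real_alg F ar \<delta> I"
    and mono: "strictly_monotone real_alg F ar \<delta> I" and comp: "compatible real_alg \<delta> I R"
    using alg by (auto simp: polynomially_terminating_def)
  have I: "\<forall>f\<in>F. I f \<in> mpolys real_alg (ar f)" using int by (simp add: poly_interpretation_def)
  have "poly_interpretation UNIV F ar \<delta> I"
    unfolding poly_interpretation_def
  proof (intro conjI ballI allI impI)
    show "\<delta> \<in> UNIV" "\<delta> > 0" using int by (auto simp: poly_interpretation_def)
    fix f assume f: "f \<in> F"
    then show "I f \<in> mpolys UNIV (ar f)" using I by (auto simp: mpolys_def)
    fix xs assume xs: "length xs = ar f \<and> set xs \<subseteq> nonneg UNIV"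
    have "(\<lambda>k. eval_mpoly (I f) (map (approx_above k) xs)) \<longlonglongrightarrow> eval_mpoly (I f) xs"
      using I f xs by (intro eval_mpoly_tendsto) (auto simp: approx_above_tendsto)
    moreover have "eval_mpoly (I f) (map (approx_above k) xs) \<ge> 0" for k
    proof -
      have "set (map (approx_above k) xs) \<subseteq> nonneg real_alg"
        using xs by (auto simp: nonneg_def[of UNIV] intro!: approx_nonneg)
      then show ?thesis using int f xs by (simp add: poly_interpretation_def nonneg_def)
    qed
    ultimately have "eval_mpoly (I f) xs \<ge> 0" by (intro LIMSEQ_le_const) auto
    then show "eval_mpoly (I f) xs \<in> nonneg UNIV" by (simp add: nonneg_def)
  qed
  moreover have "strictly_monotone UNIV F ar \<delta> I"
    unfolding strictly_monotone_def
  proof (intro ballI allI impI)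
    fix f xs i y
    assume f: "f \<in> F" and xs: "length xs = ar f \<and> set xs \<subseteq> nonneg UNIV" and i: "i < ar f"
      and y: "y \<in> nonneg UNIV" and gt: "gt_delta \<delta> (xs ! i) y"
    \<comment> \<open>Rounding the arguments up and \<open>y\<close> down can only widen the gap
      between \<open>xs ! i\<close> and \<open>y\<close>, so the algebraic monotonicity condition
      applies for every \<open>k\<close>.\<close>
    let ?a = "\<lambda>k. map (approx_above k) xs" and ?b = "\<lambda>k. (map (approx_above k) xs)[i := approx_below k y]"
    have "(\<lambda>k. eval_mpoly (I f) (?a k) - eval_mpoly (I f) (?b k)) \<longlonglongrightarrow>
        eval_mpoly (I f) xs - eval_mpoly (I f) (xs[i := y])"
      using I f xs i
      by (intro tendsto_diff eval_mpoly_tendsto)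
        (auto simp: approx_above_tendsto approx_below_tendsto nth_list_update)
    moreover have "eval_mpoly (I f) (?a k) - eval_mpoly (I f) (?b k) \<ge> \<delta>" for k
    proof -
      have "set (?a k) \<subseteq> nonneg real_alg" "approx_below k y \<in> nonneg real_alg"
        using xs y by (auto simp: nonneg_def[of UNIV] intro!: approx_nonneg)
      moreover have "gt_delta \<delta> (?a k ! i) (approx_below k y)"
        using gt i xs approx_above_ge[of "xs ! i" k] approx_below_le[of k y]
        by (simp add: gt_delta_def)
      ultimately show ?thesis
        using mono f xs i unfolding strictly_monotone_def gt_delta_def by (metis length_map)
    qed
    ultimately have "eval_mpoly (I f) xs - eval_mpoly (I f) (xs[i := y]) \<ge> \<delta>"
      by (intro LIMSEQ_le_const) auto
    then show "gt_delta \<delta> (eval_mpoly (I f) xs) (eval_mpoly (I f) (xs[i := y]))"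
      by (simp add: gt_delta_def)
  qed
  moreover have "compatible UNIV \<delta> I R"
    unfolding compatible_def
  proof (intro ballI, clarify)
    fix l r and \<alpha> :: "'b \<Rightarrow> real"
    assume lr: "(l, r) \<in> R" and \<alpha>: "\<forall>x. \<alpha> x \<in> nonneg UNIV"
    let ?a = "\<lambda>k x. approx_above k (\<alpha> x)"
    have wf: "wf_trm F ar l" "wf_trm F ar r" using R lr by (auto simp: is_trs_def is_rule_def)
    have "(\<lambda>k. eval_trm I (?a k) l - eval_trm I (?a k) r) \<longlonglongrightarrow> eval_trm I \<alpha> l - eval_trm I \<alpha> r"
      by (intro tendsto_diff eval_trm_tendsto[OF wf(1) I] eval_trm_tendsto[OF wf(2) I]
          approx_above_tendsto)
    moreover have "eval_trm I (?a k) l - eval_trm I (?a k) r \<ge> \<delta>" for k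
    proof -
      have "\<forall>x. ?a k x \<in> nonneg real_alg"
        using \<alpha> by (auto simp: nonneg_def[of UNIV] intro!: approx_nonneg)
      then show ?thesis using comp lr by (fastforce simp: compatible_def gt_delta_def)
    qed
    ultimately have "eval_trm I \<alpha> l - eval_trm I \<alpha> r \<ge> \<delta>" by (intro LIMSEQ_le_const) auto
    then show "gt_delta \<delta> (eval_trm I \<alpha> l) (eval_trm I \<alpha> r)" by (simp add: gt_delta_def)
  qed
  ultimately show ?thesis unfolding polynomially_terminating_def by blast
qed

section \<open>From real to algebraic interpretations\<close>

text \<open>\<open>Delta\<close> and \<open>Coef f m\<close> are the unknowns of an interpretation with the monomials of a given one, while
  \<open>Arg\<close> and \<open>Asg\<close> index the universally quantified arguments and assignments.\<close>

datatype ('f, 'v) idx = Delta | Coef 'f "nat \<Rightarrow>\<^sub>0 nat" | Arg nat | Asg 'v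

text \<open>Keeping to the monomials of \<open>I f\<close> leaves finitely many unknown coefficients
  for each symbol; some may be \<open>0\<close>, so the support can shrink.\<close>

definition inst :: "('f \<Rightarrow> real_mpoly) \<Rightarrow> (('f, 'v) idx \<Rightarrow> real) \<Rightarrow> 'f \<Rightarrow> real_mpoly" where
  "inst I c f = (\<Sum>m\<in>Poly_Mapping.keys (I f). Poly_Mapping.single m (c (Coef f m)))"

lemma lookup_inst:
  "Poly_Mapping.lookup (inst I c f) m =
     (if m \<in> Poly_Mapping.keys (I f) then c (Coef f m) else 0)"
  by (simp add: inst_def lookup_sum lookup_single when_def)

lemma keys_inst: "Poly_Mapping.keys (inst I c f) \<subseteq> Poly_Mapping.keys (I f)"
  by (auto simp: in_keys_iff lookup_inst split: if_splits)

text \<open>The support of \<open>inst I c f\<close> varies with \<open>c\<close>. Summing over the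
  fixed monomials of \<open>I f\<close> makes the value visibly polynomial in
  \<open>c\<close>.\<close>

lemma eval_mpoly_inst:
  "eval_mpoly (inst I c f) xs = (\<Sum>m\<in>Poly_Mapping.keys (I f). c (Coef f m) *
     (\<Prod>i\<in>Poly_Mapping.keys m. (xs ! i) ^ Poly_Mapping.lookup m i))"
proof -
  have "eval_mpoly (inst I c f) xs = (\<Sum>m\<in>Poly_Mapping.keys (I f). Poly_Mapping.lookup (inst I c f) m *
     (\<Prod>i\<in>Poly_Mapping.keys m. (xs ! i) ^ Poly_Mapping.lookup m i))"
    unfolding eval_mpoly_def 
    by (rule sum.mono_neutral_left[OF finite_keys keys_inst]) (simp add: in_keys_iff)
  then show ?thesis by (simp add: lookup_inst)
qed

lemma inst_cong: "(\<And>f m. c (Coef f m) = d (Coef f m)) \<Longrightarrow> inst I c = inst I d"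
  by (simp add: inst_def fun_eq_iff)

lemma inst_mpolys:
  assumes "I f \<in> mpolys UNIV n" "\<And>m. m \<in> Poly_Mapping.keys (I f) \<Longrightarrow> c (Coef f m) \<in> D"
  shows "inst I c f \<in> mpolys D n"
  using assms keys_inst[of I c f] by (force simp: mpolys_def lookup_inst)

lemma eval_trm_cong: "(\<And>x. x \<in> vars_trm t \<Longrightarrow> \<alpha> x = \<beta> x) \<Longrightarrow> eval_trm I \<alpha> t = eval_trm I \<beta> t"
proof (induction t)
  case (Fun f ts)
  then have "map (eval_trm I \<alpha>) ts = map (eval_trm I \<beta>) ts" by auto
  then show ?case by (simp only: eval_trm.simps)
qed simp

lemma finite_vars_trm: "finite (vars_trm t)"
  by (induction t) auto

lemma eval_inst_polyfuns:
  assumes "\<And>m. m \<in> Poly_Mapping.keys (I f) \<Longrightarrow> Coef f m \<in> V" "I f \<in> mpolys D n"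
    "\<And>i. i < n \<Longrightarrow> (\<lambda>c. xs c ! i) \<in> polyfuns V"
  shows "(\<lambda>c. eval_mpoly (inst I c f) (xs c)) \<in> polyfuns V"
  unfolding eval_mpoly_inst
  by (intro polyfuns_sum polyfuns.mult polyfuns.var polyfuns_prod polyfuns_power assms)
    (use assms(2) in \<open>auto simp: mpolys_def\<close>)

lemma eval_trm_polyfuns:
  assumes "\<And>f m. f \<in> F \<Longrightarrow> m \<in> Poly_Mapping.keys (I f) \<Longrightarrow> Coef f m \<in> V"
    "\<forall>f\<in>F. I f \<in> mpolys D (ar f)" "wf_trm F ar t" "Asg ` vars_trm t \<subseteq> V"
  shows "(\<lambda>c. eval_trm (inst I c) (\<lambda>x. c (Asg x)) t) \<in> polyfuns V"
  using assms(3,4)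
proof (induction t)
  case (Var x)
  then show ?case by (auto intro: polyfuns.var)
next
  case (Fun f ts)
  have "(\<lambda>c. map (eval_trm (inst I c) (\<lambda>x. c (Asg x))) ts ! i) \<in> polyfuns V" if "i < ar f" for i
    using that Fun by (auto simp: image_subset_iff)
  then show ?case
    using eval_inst_polyfuns[of I f V D "ar f"] assms(1,2) Fun.prems by simp
qed

definition args :: "nat \<Rightarrow> (('f, 'v) idx \<Rightarrow> real) \<Rightarrow> real list" where
  "args n c = map (\<lambda>i. c (Arg i)) [0..<n]"

lemma length_args [simp]: "length (args n c) = n"
  by (simp add: args_def)

lemma args_nth: "i < n \<Longrightarrow> args n c ! i = c (Arg i)"
  by (simp add: args_def)

text \<open>Quantification over argument lists becomes quantification over the coordinates
  \<open>Arg i\<close>. By \<open>cong\<close>, \<open>P\<close> reads its first argument only at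
  \<open>Delta\<close> and \<open>Coef\<close>, so overwriting the \<open>Arg\<close> coordinates is
  harmless.\<close>

lemma sign_definable_all_args:
  fixes P :: "(('f, 'v) idx \<Rightarrow> real) \<Rightarrow> real list \<Rightarrow> bool"
  assumes "sign_definable (V \<union> Arg ` {..<n}) {c. P c (args n c)}" "V \<inter> range Arg = {}"
    and cong: "\<And>c d xs. c Delta = d Delta \<Longrightarrow> (\<And>f m. c (Coef f m) = d (Coef f m)) \<Longrightarrow> P c xs = P d xs"
  shows "sign_definable V {c. \<forall>xs. length xs = n \<longrightarrow> P c xs}"
proof -
  have "(\<forall>xs. length xs = n \<longrightarrow> P c xs) \<longleftrightarrow>
      (\<forall>d. (\<forall>i. i \<notin> Arg ` {..<n} \<longrightarrow> d i = c i) \<longrightarrow> P d (args n d))" (is "?L \<longleftrightarrow> ?R") for c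
  proof
    assume L: ?L
    show ?R
    proof (intro allI impI)
      fix d assume d: "\<forall>i. i \<notin> Arg ` {..<n} \<longrightarrow> d i = c i"
      have "P c (args n d)" using L by (simp add: args_def)
      moreover have "P d (args n d) = P c (args n d)" using d by (intro cong) auto
      ultimately show "P d (args n d)" by simp
    qed
  next
    assume R: ?R
    show ?L
    proof (intro allI impI)
      fix xs :: "real list" assume xs: "length xs = n"
      define d where "d = (\<lambda>i. case i of Arg j \<Rightarrow> if j < n then xs ! j else c i | _ \<Rightarrow> c i)"
      have "d i = c i" if "i \<notin> Arg ` {..<n}" for i using that by (auto simp: d_def split: idx.split)
      then have "P d (args n d)" using R by blast
      moreover have "args n d = xs" using xs by (intro nth_equalityI) (auto simp: args_def d_def)
      moreover have "P d xs = P c xs" by (intro cong) (auto simp: d_def)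
      ultimately show "P c xs" by simp
    qed
  qed
  moreover have "V \<union> Arg ` {..<n} - Arg ` {..<n} = V" using assms(2) by blast
  ultimately show ?thesis using sign_definable_all[OF _ assms(1), of "Arg ` {..<n}"] by simp
qed

lemma polynomially_terminating_real_imp_real_alg:
  fixes F :: "'f set" and R :: "(('f, 'v) trm \<times> ('f, 'v) trm) set"
  assumes "finite F" "is_trs F ar R" "finite R" "polynomially_terminating UNIV F ar R"
  shows "polynomially_terminating real_alg F ar R"
proof -
  obtain \<delta> I where int: "poly_interpretation UNIV F ar \<delta> I"
    and mono: "strictly_monotone UNIV F ar \<delta> I" and comp: "compatible UNIV \<delta> I R"
    using assms(4) by (auto simp: polynomially_terminating_def)
  have I: "\<forall>f\<in>F. I f \<in> mpolys UNIV (ar f)" using int by (simp add: poly_interpretation_def)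
  define V :: "('f, 'v) idx set"
    where "V = insert Delta (\<Union>f\<in>F. Coef f ` Poly_Mapping.keys (I f))"
  have finV: "finite V" using assms(1) by (simp add: V_def)
  have DeltaV: "Delta \<in> V \<union> W" and CoefV: "f \<in> F \<Longrightarrow> m \<in> Poly_Mapping.keys (I f) \<Longrightarrow> Coef f m \<in> V \<union> W"
    for f m W by (auto simp: V_def)
  have V: "V \<inter> range Arg = {}" "V \<inter> range Asg = {}" by (auto simp: V_def)
  \<comment> \<open>\<open>S\<close> still quantifies over real arguments: an algebraic point of it
    satisfies the real conditions, and these restrict to algebraic arguments.\<close>
  define S :: "(('f, 'v) idx \<Rightarrow> real) set" where
    "S = {c. poly_interpretation UNIV F ar (c Delta) (inst I c) \<and>
       strictly_monotone UNIV F ar (c Delta) (inst I c) \<and> compatible UNIV (c Delta) (inst I c) R}"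

  have "sign_definable V {c. \<forall>xs. length xs = ar f \<longrightarrow>
      (\<forall>i\<in>{..<ar f}. 0 \<le> xs ! i) \<longrightarrow> 0 \<le> eval_mpoly (inst I c f) xs}" if f: "f \<in> F" for f
  proof (rule sign_definable_all_args)
    let ?V = "V \<union> Arg ` {..<ar f}"
    have arg: "(\<lambda>c. args (ar f) c ! i) \<in> polyfuns ?V" if "i < ar f" for i
      using that by (simp add: args_nth polyfuns.var)
    then show "sign_definable ?V {c. (\<forall>i\<in>{..<ar f}. 0 \<le> args (ar f) c ! i) \<longrightarrow>
        0 \<le> eval_mpoly (inst I c f) (args (ar f) c)}"
      using I f by (intro sign_definable_imp sign_definable_Ball sign_definable_nonneg
          eval_inst_polyfuns[where n = "ar f"] CoefV) auto
    show "((\<forall>i\<in>{..<ar f}. 0 \<le> xs ! i) \<longrightarrow> 0 \<le> eval_mpoly (inst I c f) xs) =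
        ((\<forall>i\<in>{..<ar f}. 0 \<le> xs ! i) \<longrightarrow> 0 \<le> eval_mpoly (inst I d f) xs)"
      if "\<And>f m. c (Coef f m) = d (Coef f m)" for c d :: "('f, 'v) idx \<Rightarrow> real" and xs
      using inst_cong[of c d I] that by simp
  qed (fact V)
  moreover have set_nonneg: "set xs \<subseteq> nonneg UNIV \<longleftrightarrow> (\<forall>i\<in>{..<length xs}. 0 \<le> xs ! i)" for xs
    by (auto simp: nonneg_def subset_iff in_set_conv_nth)
  then have "(\<forall>xs. length xs = ar f \<and> set xs \<subseteq> nonneg UNIV \<longrightarrow> eval_mpoly (J f) xs \<in> nonneg UNIV) \<longleftrightarrow>
      (\<forall>xs. length xs = ar f \<longrightarrow> (\<forall>i\<in>{..<ar f}. 0 \<le> xs ! i) \<longrightarrow> 0 \<le> eval_mpoly (J f) xs)" for f J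
    by (auto simp: nonneg_def[of UNIV])
  moreover have "inst I c f \<in> mpolys UNIV (ar f)" if "f \<in> F" for f and c :: "('f, 'v) idx \<Rightarrow> real"
    using inst_mpolys[of I f] I that by blast
  moreover have "sign_definable V {c. c Delta > 0}"
    by (intro sign_definable_pos polyfuns.var) (simp add: V_def)
  ultimately have "sign_definable V {c. poly_interpretation UNIV F ar (c Delta) (inst I c)}"
    unfolding poly_interpretation_def using assms(1)
    by (simp add: sign_definable_conj sign_definable_Ball cong: conj_cong ball_cong)

  moreover have "sign_definable V {c. strictly_monotone UNIV F ar (c Delta) (inst I c)}"
  proof -
    \<comment> \<open>The new argument \<open>y\<close> is stored as the last entry of a list of
      length \<open>Suc (ar f)\<close>, so that one block of \<open>Arg\<close> variables covers
      both.\<close>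
    define P where "P = (\<lambda>f i (c :: ('f, 'v) idx \<Rightarrow> real) zs. (\<forall>j\<in>{..<Suc (ar f)}. 0 \<le> zs ! j) \<longrightarrow>
      0 \<le> zs ! i - zs ! ar f - c Delta \<longrightarrow>
      0 \<le> eval_mpoly (inst I c f) (take (ar f) zs)
        - eval_mpoly (inst I c f) ((take (ar f) zs)[i := zs ! ar f]) - c Delta)"
    have "sign_definable V {c. \<forall>zs. length zs = Suc (ar f) \<longrightarrow> P f i c zs}"
      if f: "f \<in> F" and i: "i < ar f" for f i
    proof (rule sign_definable_all_args)
      let ?V = "V \<union> Arg ` {..<Suc (ar f)}"
      have arg: "(\<lambda>c. args (Suc (ar f)) c ! i) \<in> polyfuns ?V" if "i < Suc (ar f)" for i
        using that by (simp add: args_nth polyfuns.var)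
      have upd: "(\<lambda>c. (take (ar f) (args (Suc (ar f)) c))[i := args (Suc (ar f)) c ! ar f] ! j) \<in> polyfuns ?V"
        if "j < ar f" for j
        using that arg[of j] arg[of "ar f"] by (cases "i = j") simp_all
      have tk: "(\<lambda>c. take (ar f) (args (Suc (ar f)) c) ! j) \<in> polyfuns ?V" if "j < ar f" for j
        using that arg[of j] by simp
      have delta: "(\<lambda>c. c Delta) \<in> polyfuns ?V" by (intro polyfuns.var DeltaV)
      have If: "I f \<in> mpolys UNIV (ar f)" using I f by blast
      have ev: "(\<lambda>c. eval_mpoly (inst I c f) (take (ar f) (args (Suc (ar f)) c))) \<in> polyfuns ?V"
          "(\<lambda>c. eval_mpoly (inst I c f) ((take (ar f) (args (Suc (ar f)) c))
             [i := args (Suc (ar f)) c ! ar f])) \<in> polyfuns ?V"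
        by (rule eval_inst_polyfuns[of I f ?V UNIV "ar f"]; use f If tk upd CoefV in blast)+
      show "sign_definable ?V {c. P f i c (args (Suc (ar f)) c)}"
        unfolding P_def
        by (intro sign_definable_imp sign_definable_Ball sign_definable_nonneg polyfuns_diff
            delta ev arg)
          (use i in auto)
      show "P f i c xs = P f i d xs"
        if "c Delta = d Delta" "\<And>f m. c (Coef f m) = d (Coef f m)" for c d xs
        using inst_cong[of c d I] that by (simp add: P_def)
    qed (fact V)
    then have "sign_definable V {c. \<forall>f\<in>F. \<forall>i\<in>{..<ar f}. \<forall>zs. length zs = Suc (ar f) \<longrightarrow> P f i c zs}"
      using assms(1) by (intro sign_definable_Ball) auto
    moreover have "strictly_monotone UNIV F ar (c Delta) (inst I c) \<longleftrightarrow>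
        (\<forall>f\<in>F. \<forall>i\<in>{..<ar f}. \<forall>zs. length zs = Suc (ar f) \<longrightarrow> P f i c zs)" (is "?L \<longleftrightarrow> ?R") for c
    proof
      assume L: ?L
      show ?R
      proof (intro ballI allI impI)
        fix f i and zs :: "real list"
        assume f: "f \<in> F" and i: "i \<in> {..<ar f}" and zs: "length zs = Suc (ar f)"
        show "P f i c zs" unfolding P_def
        proof (intro impI)
          assume nn: "\<forall>j\<in>{..<Suc (ar f)}. 0 \<le> zs ! j" and gt: "0 \<le> zs ! i - zs ! ar f - c Delta"
          have "length (take (ar f) zs) = ar f" "set (take (ar f) zs) \<subseteq> nonneg UNIV"
              "zs ! ar f \<in> nonneg UNIV" "gt_delta (c Delta) (take (ar f) zs ! i) (zs ! ar f)"
            using nn gt zs i by (auto simp: nonneg_def gt_delta_def set_conv_nth)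
          then show "0 \<le> eval_mpoly (inst I c f) (take (ar f) zs)
              - eval_mpoly (inst I c f) ((take (ar f) zs)[i := zs ! ar f]) - c Delta"
            using L f i unfolding strictly_monotone_def gt_delta_def by simp
        qed
      qed
    next
      assume R: ?R
      show ?L unfolding strictly_monotone_def
      proof (intro ballI allI impI)
        fix f xs i y
        assume f: "f \<in> F" and xs: "length xs = ar f \<and> set xs \<subseteq> nonneg UNIV" and i: "i < ar f"
          and y: "y \<in> nonneg UNIV" and gt: "gt_delta (c Delta) (xs ! i) y"
        have "P f i c (xs @ [y])" using R f i xs by simp
        moreover have "\<forall>j<ar f. 0 \<le> xs ! j" "0 \<le> y"
          using xs y set_nonneg[of xs] by (auto simp: nonneg_def[of UNIV])
        then have "\<forall>j\<in>{..<Suc (ar f)}. 0 \<le> (xs @ [y]) ! j"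
          using xs by (auto simp: nth_append less_Suc_eq)
        ultimately show "gt_delta (c Delta) (eval_mpoly (inst I c f) xs) (eval_mpoly (inst I c f) (xs[i := y]))"
          using xs i gt by (simp add: P_def gt_delta_def nth_append)
      qed
    qed
    ultimately show ?thesis by simp
  qed

  moreover have "sign_definable V {c. compatible UNIV (c Delta) (inst I c) R}"
  proof -
    \<comment> \<open>Nonnegativity is required only for the variables of the rule, which makes the
      quantified block \<open>W l r\<close> finite.\<close>
    define Q where "Q = (\<lambda>l r (c :: ('f, 'v) idx \<Rightarrow> real). (\<forall>x\<in>vars_trm l \<union> vars_trm r. 0 \<le> c (Asg x)) \<longrightarrow>
      0 \<le> eval_trm (inst I c) (\<lambda>x. c (Asg x)) l - eval_trm (inst I c) (\<lambda>x. c (Asg x)) r - c Delta)"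
    define W :: "('f, 'v) trm \<Rightarrow> ('f, 'v) trm \<Rightarrow> ('f, 'v) idx set"
      where "W = (\<lambda>l r. Asg ` (vars_trm l \<union> vars_trm r))"
    have "sign_definable V {c. \<forall>d. (\<forall>i. i \<notin> W l r \<longrightarrow> d i = c i) \<longrightarrow> Q l r d}" if lr: "(l, r) \<in> R" for l r
    proof -
      have wf: "wf_trm F ar l" "wf_trm F ar r" using assms(2) lr by (auto simp: is_trs_def is_rule_def)
      have sub: "Asg ` vars_trm l \<subseteq> V \<union> W l r" "Asg ` vars_trm r \<subseteq> V \<union> W l r" by (auto simp: W_def)
      have "sign_definable (V \<union> W l r) {c. Q l r c}"
        unfolding Q_def
        by (intro sign_definable_imp sign_definable_Ball sign_definable_nonneg polyfuns_diff
            eval_trm_polyfuns[OF CoefV I wf(1) sub(1)] eval_trm_polyfuns[OF CoefV I wf(2) sub(2)]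
            polyfuns.var DeltaV) (use sub in \<open>auto simp: finite_vars_trm\<close>)
      moreover have "V \<union> W l r - W l r = V" using V by (auto simp: W_def)
      moreover have "finite (W l r)" by (simp add: W_def finite_vars_trm)
      ultimately show ?thesis using sign_definable_all[of "W l r" "V \<union> W l r" "Q l r"] by simp
    qed
    then have "sign_definable V {c. \<forall>\<rho>\<in>R. \<forall>d. (\<forall>i. i \<notin> W (fst \<rho>) (snd \<rho>) \<longrightarrow> d i = c i) \<longrightarrow>
        Q (fst \<rho>) (snd \<rho>) d}"
      using assms(3) by (intro sign_definable_Ball) auto
    moreover have "(\<forall>\<alpha>. (\<forall>x. \<alpha> x \<in> nonneg UNIV) \<longrightarrow>
          gt_delta (c Delta) (eval_trm (inst I c) \<alpha> l) (eval_trm (inst I c) \<alpha> r)) \<longleftrightarrow>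
        (\<forall>d. (\<forall>i. i \<notin> W l r \<longrightarrow> d i = c i) \<longrightarrow> Q l r d)" (is "?L \<longleftrightarrow> ?R") for c l r
    proof
      assume L: ?L
      show ?R
      proof (intro allI impI)
        fix d assume d: "\<forall>i. i \<notin> W l r \<longrightarrow> d i = c i"
        have eq: "inst I d = inst I c" "d Delta = c Delta" using d by (auto simp: W_def intro!: inst_cong)
        show "Q l r d" unfolding Q_def eq
        proof
          assume nn: "\<forall>x\<in>vars_trm l \<union> vars_trm r. 0 \<le> d (Asg x)"
          \<comment> \<open>Variables outside the rule get the value \<open>0\<close> because an
            assignment must be nonnegative everywhere, whereas \<open>d\<close> may be negative
            there.\<close>
          define \<alpha> where "\<alpha> = (\<lambda>x. if x \<in> vars_trm l \<union> vars_trm r then d (Asg x) else 0)"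
          have "\<forall>x. \<alpha> x \<in> nonneg UNIV" using nn by (simp add: \<alpha>_def nonneg_def)
          then have "gt_delta (c Delta) (eval_trm (inst I c) \<alpha> l) (eval_trm (inst I c) \<alpha> r)" using L by blast
          moreover have "eval_trm (inst I c) \<alpha> l = eval_trm (inst I c) (\<lambda>x. d (Asg x)) l"
              "eval_trm (inst I c) \<alpha> r = eval_trm (inst I c) (\<lambda>x. d (Asg x)) r"
            by (auto simp: \<alpha>_def intro!: eval_trm_cong)
          ultimately show "0 \<le> eval_trm (inst I c) (\<lambda>x. d (Asg x)) l
              - eval_trm (inst I c) (\<lambda>x. d (Asg x)) r - c Delta"
            by (simp add: gt_delta_def)
        qed
      qed
    next
      assume R: ?R
      show ?L
      proof (intro allI impI)
        fix \<alpha> :: "'v \<Rightarrow> real" assume \<alpha>: "\<forall>x. \<alpha> x \<in> nonneg UNIV"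
        define d where "d = (\<lambda>i. case i of Asg x \<Rightarrow> if i \<in> W l r then \<alpha> x else c i | _ \<Rightarrow> c i)"
        have "\<forall>i. i \<notin> W l r \<longrightarrow> d i = c i" by (simp add: d_def split: idx.split)
        then have "Q l r d" using R by blast
        moreover have eq: "inst I d = inst I c" "d Delta = c Delta" by (auto simp: d_def intro!: inst_cong)
        moreover have "eval_trm (inst I c) \<alpha> l = eval_trm (inst I c) (\<lambda>x. d (Asg x)) l"
            "eval_trm (inst I c) \<alpha> r = eval_trm (inst I c) (\<lambda>x. d (Asg x)) r"
          by (auto simp: d_def W_def intro!: eval_trm_cong)
        moreover have "\<forall>x\<in>vars_trm l \<union> vars_trm r. 0 \<le> d (Asg x)"
          using \<alpha> by (auto simp: d_def W_def nonneg_def)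
        ultimately show "gt_delta (c Delta) (eval_trm (inst I c) \<alpha> l) (eval_trm (inst I c) \<alpha> r)"
          by (simp add: Q_def gt_delta_def)
      qed
    qed
    ultimately show ?thesis unfolding compatible_def by (simp add: case_prod_beta)
  qed
  ultimately have "sign_definable V S" unfolding S_def by (intro sign_definable_conj)
  moreover have "S \<noteq> {}"
  proof -
    \<comment> \<open>The given real interpretation itself, read as a point of
      \<open>S\<close>.\<close>
    define c :: "('f, 'v) idx \<Rightarrow> real" where
      "c = (\<lambda>i. case i of Delta \<Rightarrow> \<delta> | Coef f m \<Rightarrow> Poly_Mapping.lookup (I f) m | _ \<Rightarrow> 0)"
    have "inst I c f = I f" for f by (rule poly_mapping_eqI) (simp add: lookup_inst c_def in_keys_iff)
    then have "inst I c = I" by blast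
    then have "c \<in> S" using int mono comp by (simp add: S_def c_def)
    then show ?thesis by blast
  qed
  ultimately obtain c where c: "c \<in> S" "\<forall>i\<in>V. algebraic (c i)" using algebraic_point finV by blast
  have int': "poly_interpretation UNIV F ar (c Delta) (inst I c)"
    and mono': "strictly_monotone UNIV F ar (c Delta) (inst I c)"
    and comp': "compatible UNIV (c Delta) (inst I c) R"
    using c(1) by (auto simp: S_def)
  have sub: "x \<in> nonneg real_alg \<Longrightarrow> x \<in> nonneg UNIV" for x by (simp add: nonneg_def)
  have mp: "inst I c f \<in> mpolys real_alg (ar f)" if "f \<in> F" for f
    using I that c(2) by (intro inst_mpolys) (auto simp: V_def real_alg_def)
  \<comment> \<open>The inequalities are inherited from the reals; what has to be added is that
    values stay algebraic, by closure under sums and products.\<close>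
  have "poly_interpretation real_alg F ar (c Delta) (inst I c)"
    unfolding poly_interpretation_def
  proof (intro conjI ballI allI impI mp)
    show "c Delta \<in> real_alg" using c(2) by (simp add: V_def real_alg_def)
    show "c Delta > 0" using int' by (simp add: poly_interpretation_def)
    fix f xs assume f: "f \<in> F" and xs: "length xs = ar f \<and> set xs \<subseteq> nonneg real_alg"
    have "eval_mpoly (inst I c f) xs \<in> real_alg"
      using mp[OF f] xs by (intro eval_mpoly_real_alg) (auto simp: nonneg_def)
    moreover have "eval_mpoly (inst I c f) xs \<in> nonneg UNIV"
      using int' f xs sub unfolding poly_interpretation_def by blast
    ultimately show "eval_mpoly (inst I c f) xs \<in> nonneg real_alg" by (simp add: nonneg_def)
  qed
  moreover have "strictly_monotone real_alg F ar (c Delta) (inst I c)"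
    using mono' sub unfolding strictly_monotone_def by blast
  moreover have "compatible real_alg (c Delta) (inst I c) R"
    using comp' sub unfolding compatible_def by blast
  ultimately show ?thesis unfolding polynomially_terminating_def by blast
qed

theorem theorem3p4:
  fixes F :: "'f set" and ar :: "'f \<Rightarrow> nat" and R :: "(('f, 'v) trm \<times> ('f, 'v) trm) set"
  assumes "finite F" and "is_trs F ar R" and "finite R"
  shows "polynomially_terminating UNIV F ar R \<longleftrightarrow> polynomially_terminating real_alg F ar R"
  using polynomially_terminating_real_imp_real_alg polynomially_terminating_real_alg_imp_real assms
  by blast

end
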